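(* Let $(A,H,D)$ be the spectral triple on the three-point space $Y=\{1,2,3\}$ given in the context, and let $(\Omega,d,* )$ be the differential $*$-calculus of Connes forms of $(A,H,D)$, so that $e_1=[D,\chi_1]$, $e_2=[D,\chi_2]$ is a free right $A$-module basis of $\Omega^1$. Then there are exactly $8$ complex structures $J$ on $(\Omega,d,* )$. Describing $J$ by the matrix $(J_{ki})_{k,i=1,2}$ with entries in $A$ of its restriction to $\Omega^1$, where $Je_i=e_1J_{1i}+e_2J_{2i}$ for $i=1,2$, they are the following, where $i=\sqrt{-1}$ in front of the matrices: $$\pm i\begin{bmatrix}1-2\chi_3&0\\2\chi_1&2\chi_2-1\end{bmatrix},\qquad \pm i\begin{bmatrix}1-2\chi_3&-2\chi_2\\2\chi_1&2\chi_3-1\end{bmatrix},$$ $$\pm i\begin{bmatrix}2\chi_1-1&2\chi_2\\0&1-2\chi_3\end{bmatrix},\qquad \pm i\begin{bmatrix}2\chi_1-1&0\\0&1-2\chi_2\end{bmatrix}.$$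
   Context: **The spectral triple.** Let $Y=\{1,2,3\}$ and let $A=\mathcal{C}(Y)\cong\mathbb{C}^3$ be the $*$-algebra of complex functions on $Y$ (pointwise operations, complex conjugation). The functions $\chi_i$ are defined by $\chi_i(j)=\delta_{ij}$, $i,j\in\{1,2,3\}$. Let $H=\mathbb{C}^2_{12}\oplus\mathbb{C}^2_{23}\oplus\mathbb{C}^2_{13}$ (three copies of $\mathbb{C}^2$). Define $\pi:A\to B(H)$ by $$\pi(f)=\begin{bmatrix} f(1)&0\\0&f(2)\end{bmatrix}_{12}\oplus\begin{bmatrix} f(2)&0\\0&f(3)\end{bmatrix}_{23}\oplus\begin{bmatrix} f(1)&0\\0&f(3)\end{bmatrix}_{13},$$ $$D=\begin{bmatrix}0&1\\1&0\end{bmatrix}_{12}\oplus\begin{bmatrix}0&1\\1&0\end{bmatrix}_{23}\oplus\begin{bmatrix}0&1\\1&0\end{bmatrix}_{13}.$$ Elements $a\in A$ are identified with $\pi(a)$, and $[D,a]=D\pi(a)-\pi(a)D$. **Connes forms.** Let $\Omega_u^1A$ be the kernel of the multiplication $A\otimes A\to A$ and $\Omega_uA=T_A(\Omega_u^1A)$ the universal differential graded algebra (tensor algebra over $A$), with the unique degree one (graded) differential $d$ such that $d(a)=1\otimes a-a\otimes 1$ for $a\in A$. Let $\pi_u:\Omega_uA\to B(H)$, $\pi_u(a_0da_1\cdots da_p)=a_0[D,a_1]\cdots[D,a_p]$. Let $\mathcal{J}_0=\bigoplus_p\mathcal{J}_0^p$ with $\mathcal{J}_0^p=\{\omega\in\Omega_u^pA\mid\pi_u(\omega)=0\}$,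 and let $\mathcal{J}=\mathcal{J}_0+d\mathcal{J}_0$, which is a graded differential ideal. The differential graded algebra of Connes forms is $\Omega=\Omega_uA/\mathcal{J}=\bigoplus_n\Omega^n$, with product written $\wedge$ and $\Omega^0=A$. Its degree-one part $\Omega^1$ is identified via $\pi_u$ with the $A$-bimodule of operators $\sum_j a_0^j[D,a_1^j]$, with $da=[D,a]$. It is a differential $*$-calculus: the involution of $A$ extends to a grading-preserving (conjugate-linear) involution $\xi\mapsto\xi^*$ on $\Omega$ with $d(\xi)^*=d(\xi^* )$ and $(\xi\wedge\eta)^*=(-1)^{|\xi||\eta|}\eta^*\wedge\xi^*$ for homogeneous $\xi,\eta$. In particular $[D,a]^*=[D,a^*]$ as elements of $\Omega^1$ (this is not the operator adjoint), so $e_i^*=e_i$. **Almost complex and complex structures.** An almost complex structure on a differential $*$-calculus $(\Omega,d,* )$ over $A$ is a degree zero derivation $J:\Omega\to\Omega$ such that (i) $J$ is identically $0$ on $A$ (hence is an $A$-bimodule endomorphism of $\Omega$); (ii) $J^2=-1$ on $\Omega^1$; (iii) $J(\xi^* )=J(\xi)^*$ for $\xi\in\Omega^1$. For $p,q\ge 0$ put $\Omega^{p,q}=\{\xi\in\Omega^{p+q}\mid J\xi=(p-q)\sqrt{-1}\,\xi\}$; then $\Omega^n=\bigoplus_{p+q=n}\Omega^{p,q}$. The almost complex structure $J$ is integrable if $d\Omega^{1,0}\subset\Omega^{2,0}\oplus\Omega^{1,1}$. A complex structure is an integrable almost complex structure. *)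

theory Defs
  imports "HOL-Analysis.Analysis" "HOL-Library.Function_Algebras"
begin

section \<open>The algebra and the spectral triple\<close>

text \<open>
  The space \<open>Y = {1, 2, 3}\<close> is the numeral type \<^typ>\<open>3\<close> (whose element \<open>3\<close> is another name
  of its \<open>0\<close>, distinct from \<open>1\<close> and \<open>2\<close>). The algebra \<open>A\<close> is the type of all functions
  \<open>3 \<Rightarrow> complex\<close> with the pointwise ring structure of \<^theory>\<open>HOL-Library.Function_Algebras\<close>.
\<close>

type_synonym alg = "3 \<Rightarrow> complex"

definition chr :: "3 \<Rightarrow> alg" where
  "chr i = (\<lambda>j. if i = j then 1 else 0)"

definition const_alg :: "complex \<Rightarrow> alg" where
  "const_alg c = (\<lambda>_. c)"

definition star_alg :: "alg \<Rightarrow> alg" where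
  "star_alg a = (\<lambda>y. cnj (a y))"

text \<open>The three summands are indexed by the pairs 12, 23, 13, in this order.\<close>

type_synonym hilb = "(complex ^ 2) \<times> (complex ^ 2) \<times> (complex ^ 2)"

definition scale_hilb :: "complex \<Rightarrow> hilb \<Rightarrow> hilb" where
  "scale_hilb c h = (case h of (u, v, w) \<Rightarrow> (c *s u, c *s v, c *s w))"

lemma vector_space_hilb: "vector_space scale_hilb"
  by unfold_locales
    (auto simp: scale_hilb_def vector_add_ldistrib vector_sadd_rdistrib vector_smult_assoc)

text \<open>As \<open>H\<close> is finite dimensional, \<open>B(H)\<close> consists of all complex linear maps on \<open>H\<close>.\<close>

typedef bop = "{T :: hilb \<Rightarrow> hilb. Vector_Spaces.linear scale_hilb scale_hilb T}"
  morphisms apply_bop Abs_bop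
proof
  show "(\<lambda>_. 0) \<in> {T. Vector_Spaces.linear scale_hilb scale_hilb T}"
    using vector_space_pair.linear_zero[of scale_hilb scale_hilb] vector_space_hilb
    by (simp add: vector_space_pair_def)
qed

setup_lifting type_definition_bop

lemma linear_hilb_iff:
  "Vector_Spaces.linear scale_hilb scale_hilb T \<longleftrightarrow>
    (\<forall>x y. T (x + y) = T x + T y) \<and> (\<forall>c x. T (scale_hilb c x) = scale_hilb c (T x))"
  using vector_space_hilb
  by (auto simp: Vector_Spaces.linear_def module_hom_def module_hom_axioms_def
      vector_space_def module_def)

lemma scale_hilb_right: "scale_hilb c (x + y) = scale_hilb c x + scale_hilb c y"
  "scale_hilb c (- x) = - scale_hilb c x" "scale_hilb c (x - y) = scale_hilb c x - scale_hilb c y"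
  "scale_hilb c 0 = 0"
  by (cases x; cases y; simp add: scale_hilb_def vec_eq_iff algebra_simps zero_prod_def)+

instantiation bop :: ring_1
begin

lift_definition zero_bop :: bop is "\<lambda>_. 0" by (simp add: linear_hilb_iff scale_hilb_right)
lift_definition one_bop :: bop is "\<lambda>x. x" by (simp add: linear_hilb_iff)
lift_definition plus_bop :: "bop \<Rightarrow> bop \<Rightarrow> bop" is "\<lambda>S T x. S x + T x"
  by (simp add: linear_hilb_iff scale_hilb_right algebra_simps del: split_paired_All)
lift_definition minus_bop :: "bop \<Rightarrow> bop \<Rightarrow> bop" is "\<lambda>S T x. S x - T x"
  by (simp add: linear_hilb_iff scale_hilb_right algebra_simps del: split_paired_All)
lift_definition uminus_bop :: "bop \<Rightarrow> bop" is "\<lambda>T x. - T x"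
  by (simp add: linear_hilb_iff scale_hilb_right del: split_paired_All)
lift_definition times_bop :: "bop \<Rightarrow> bop \<Rightarrow> bop" is "\<lambda>S T x. S (T x)"
  by (simp add: linear_hilb_iff del: split_paired_All)

instance
proof
  show "(0::bop) \<noteq> 1"
  proof
    assume "(0::bop) = 1"
    hence "apply_bop 0 (axis 1 1, 0, 0) = apply_bop 1 (axis 1 1, 0, 0)" by simp
    hence "axis (1::2) (1::complex) = 0" by (simp add: zero_bop.rep_eq one_bop.rep_eq zero_prod_def)
    thus False by (metis axis_nth zero_index zero_neq_one)
  qed
qed (transfer; simp add: fun_eq_iff linear_hilb_iff algebra_simps del: split_paired_All)+

end

lift_definition block_op :: "complex^2^2 \<Rightarrow> complex^2^2 \<Rightarrow> complex^2^2 \<Rightarrow> bop" is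
  "\<lambda>P Q R (u, v, w). (P *v u, Q *v v, R *v w)"
  by (auto simp: linear_hilb_iff scale_hilb_def matrix_vector_right_distrib vector_scalar_commute)

definition mat22 :: "'a::zero \<Rightarrow> 'a \<Rightarrow> 'a \<Rightarrow> 'a \<Rightarrow> 'a^2^2" where
  "mat22 a b c d = vector [vector [a, b], vector [c, d]]"

definition rep_alg :: "alg \<Rightarrow> bop" where
  "rep_alg f = block_op (mat22 (f 1) 0 0 (f 2)) (mat22 (f 2) 0 0 (f 3)) (mat22 (f 1) 0 0 (f 3))"

definition dirac :: bop where
  "dirac = block_op (mat22 0 1 1 0) (mat22 0 1 1 0) (mat22 0 1 1 0)"

definition comm_dirac :: "alg \<Rightarrow> bop" where
  "comm_dirac a = dirac * rep_alg a - rep_alg a * dirac"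

section \<open>Universal differential forms\<close>

text \<open>
  The \<open>n\<close>-fold tensor power of \<open>A = C(Y)\<close> is identified with \<open>C(Y\<^sup>n)\<close>, where
  \<open>a\<^sub>1 \<otimes> \<dots> \<otimes> a\<^sub>n\<close> is the function \<open>(y\<^sub>1, \<dots>, y\<^sub>n) \<mapsto> a\<^sub>1(y\<^sub>1) \<cdots> a\<^sub>n(y\<^sub>n)\<close>. The kernel of the
  multiplication \<open>A \<otimes> A \<rightarrow> A\<close> becomes the bimodule of functions on \<open>Y \<times> Y\<close> that vanish on the
  diagonal, and its \<open>p\<close>-fold tensor power over \<open>A\<close> the space of functions on \<open>Y\<^bsup>p+1\<^esup>\<close> that
  vanish wherever two consecutive arguments agree. Hence an element of the tensor algebra is a
  finitely supported function on lists over \<open>Y\<close>, with lists of length \<open>p + 1\<close> in degree \<open>p\<close>.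
  Lemma \<open>uform_universal\<close> below is the universal property of the tensor algebra.
\<close>

definition is_uform :: "(3 list \<Rightarrow> complex) \<Rightarrow> bool" where
  "is_uform f \<longleftrightarrow> finite {w. f w \<noteq> 0} \<and> (\<forall>w. f w \<noteq> 0 \<longrightarrow> w \<noteq> [] \<and> distinct_adj w)"

typedef uform = "{f :: 3 list \<Rightarrow> complex. is_uform f}"
  morphisms coeff_u Abs_uform
  by (rule exI[of _ "\<lambda>_. 0"]) (simp add: is_uform_def)

setup_lifting type_definition_uform

text \<open>Product of the tensor algebra:
  \<open>(f g)(y\<^sub>0, \<dots>, y\<^sub>n) = \<Sum>\<^sub>k f(y\<^sub>0, \<dots>, y\<^sub>k) g(y\<^sub>k, \<dots>, y\<^sub>n)\<close>.\<close>

definition path_mult :: "(3 list \<Rightarrow> complex) \<Rightarrow> (3 list \<Rightarrow> complex) \<Rightarrow> 3 list \<Rightarrow> complex" where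
  "path_mult f g w = (\<Sum>k<length w. f (take (Suc k) w) * g (drop k w))"

text \<open>The differential is the alternating sum over the deletions of one argument, which on
  \<open>A\<close> is \<open>(d a)(x, y) = a(y) - a(x)\<close>, that is \<open>1 \<otimes> a - a \<otimes> 1\<close>.\<close>

definition path_diff :: "(3 list \<Rightarrow> complex) \<Rightarrow> 3 list \<Rightarrow> complex" where
  "path_diff f w = (\<Sum>k<length w. (-1) ^ k * f (take k w @ drop (Suc k) w))"

text \<open>The sign in degree \<open>p\<close> is \<open>(-1)\<^bsup>p(p+1)/2\<^esup>\<close>, as forced by \<open>(d a)\<^sup>* = d (a\<^sup>*)\<close> and
  \<open>(\<xi> \<eta>)\<^sup>* = (-1)\<^bsup>|\<xi>||\<eta>|\<^esup> \<eta>\<^sup>* \<xi>\<^sup>*\<close>.\<close>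

definition path_star :: "(3 list \<Rightarrow> complex) \<Rightarrow> 3 list \<Rightarrow> complex" where
  "path_star f w = (-1) ^ ((length w - 1) * length w div 2) * cnj (f (rev w))"

lemma path_mult_Nil [simp]: "path_mult f g [] = 0"
  by (simp add: path_mult_def)

lemma path_mult_Cons:
  "path_mult f g (x # xs) = f [x] * g (x # xs) + path_mult (\<lambda>u. f (x # u)) g xs"
  by (simp add: path_mult_def sum.lessThan_Suc_shift del: sum.lessThan_Suc)

lemma path_diff_Nil [simp]: "path_diff f [] = 0"
  by (simp add: path_diff_def)

lemma path_diff_Cons: "path_diff f (x # xs) = f xs - path_diff (\<lambda>u. f (x # u)) xs"
  by (simp add: path_diff_def sum.lessThan_Suc_shift sum_negf del: sum.lessThan_Suc)

lemma path_mult_add_left: "path_mult (\<lambda>u. f u + g u) h w = path_mult f h w + path_mult g h w"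
  by (simp add: path_mult_def algebra_simps sum.distrib)

lemma path_mult_add_right: "path_mult h (\<lambda>u. f u + g u) w = path_mult h f w + path_mult h g w"
  by (simp add: path_mult_def algebra_simps sum.distrib)

lemma path_mult_diff_left: "path_mult (\<lambda>u. f u - g u) h w = path_mult f h w - path_mult g h w"
  by (simp add: path_mult_def algebra_simps sum_subtractf)

lemma path_mult_scale_left: "path_mult (\<lambda>u. c * f u) h w = c * path_mult f h w"
  by (simp add: path_mult_def algebra_simps sum_distrib_left)

lemma path_mult_scale_right: "path_mult h (\<lambda>u. c * f u) w = c * path_mult h f w"
  by (simp add: path_mult_def algebra_simps sum_distrib_left)

lemma path_diff_add: "path_diff (\<lambda>u. f u + g u) w = path_diff f w + path_diff g w"
  by (simp add: path_diff_def algebra_simps sum.distrib)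

lemma path_diff_diff: "path_diff (\<lambda>u. f u - g u) w = path_diff f w - path_diff g w"
  by (simp add: path_diff_def algebra_simps sum_subtractf)

lemma path_diff_scale: "path_diff (\<lambda>u. c * f u) w = c * path_diff f w"
  by (simp add: path_diff_def algebra_simps sum_distrib_left)

lemma path_mult_assoc: "path_mult (path_mult f g) h w = path_mult f (path_mult g h) w"
proof (induction w arbitrary: f g)
  case (Cons x xs)
  have "(\<lambda>u. path_mult f g (x # u)) =
      (\<lambda>u. f [x] * g (x # u) + path_mult (\<lambda>u. f (x # u)) g u)"
    by (simp add: path_mult_Cons)
  thus ?case
    by (simp add: path_mult_Cons path_mult_add_left path_mult_scale_left Cons algebra_simps)
qed simp

lemma path_mult_one_left:
  assumes "f [] = 0"
  shows "path_mult (\<lambda>w. if length w = 1 then 1 else 0) f = f"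
proof
  fix w
  show "path_mult (\<lambda>w. if length w = 1 then 1 else 0) f w = f w"
  proof (cases w)
    case (Cons x xs)
    have "path_mult (\<lambda>u. if length (x # u) = 1 then 1 else 0) f xs = 0"
      unfolding path_mult_def by (rule sum.neutral) auto
    thus ?thesis unfolding Cons path_mult_Cons by simp
  qed (simp add: assms)
qed

lemma path_mult_one_right:
  assumes "f [] = 0"
  shows "path_mult f (\<lambda>w. if length w = 1 then 1 else 0) = f"
proof
  fix w
  show "path_mult f (\<lambda>w. if length w = 1 then 1 else 0) w = f w"
  proof (cases w)
    case (Cons x xs)
    have "path_mult f (\<lambda>w. if length w = 1 then 1 else 0) w =
        (\<Sum>k<length w. if k = length xs then f w else 0)"
      unfolding path_mult_def by (rule sum.cong) (auto simp: Cons)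
    also have "\<dots> = f w" by (simp add: Cons)
    finally show ?thesis .
  qed (simp add: assms)
qed

lemma path_diff_twice: "path_diff (path_diff f) w = 0"
proof (induction w arbitrary: f)
  case (Cons x xs)
  have "(\<lambda>u. path_diff f (x # u)) = (\<lambda>u. f u - path_diff (\<lambda>u. f (x # u)) u)"
    by (simp add: path_diff_Cons)
  thus ?case
    by (simp add: path_diff_Cons path_diff_diff Cons)
qed simp

lemma path_diff_mult_aux:
  assumes "g [] = 0"
  shows "path_diff (path_mult f g) w =
    path_mult (path_diff f) g w - path_mult (\<lambda>u. (-1) ^ length u * f u) (path_diff g) w
      - f [] * g w"
proof (induction w arbitrary: f)
  case (Cons x xs)
  have 1: "(\<lambda>u. path_mult f g (x # u)) = (\<lambda>u. f [x] * g (x # u) + path_mult (\<lambda>u. f (x # u)) g u)"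
    by (simp add: path_mult_Cons)
  have 2: "(\<lambda>u. path_diff f (x # u)) = (\<lambda>u. f u - path_diff (\<lambda>u. f (x # u)) u)"
    by (simp add: path_diff_Cons)
  have 3: "path_mult (\<lambda>u. (-1) ^ length (x # u) * f (x # u)) h xs =
      - path_mult (\<lambda>u. (-1) ^ length u * f (x # u)) h xs" for h
    by (simp add: path_mult_def sum_negf)
  show ?case
    unfolding path_diff_Cons[of "path_mult f g"] path_mult_Cons[of "path_diff f"]
      path_mult_Cons[of "\<lambda>u. (-1) ^ length u * f u"] 1 2 3 path_diff_add path_diff_scale
      path_mult_diff_left Cons
    by (simp add: path_diff_Cons algebra_simps)
qed (simp add: assms)

lemma path_mult_nonzero:
  assumes "path_mult f g w \<noteq> 0"
  shows "\<exists>k<length w. f (take (Suc k) w) \<noteq> 0 \<and> g (drop k w) \<noteq> 0"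
proof (rule ccontr)
  assume "\<not> ?thesis"
  hence "path_mult f g w = 0" unfolding path_mult_def by (intro sum.neutral) auto
  with assms show False by blast
qed

lemma path_diff_nonzero:
  assumes "path_diff f w \<noteq> 0"
  shows "\<exists>k<length w. f (take k w @ drop (Suc k) w) \<noteq> 0"
proof (rule ccontr)
  assume "\<not> ?thesis"
  hence "path_diff f w = 0" unfolding path_diff_def by (intro sum.neutral) auto
  with assms show False by blast
qed

lemma path_mult_distinct_adj:
  assumes "path_mult f g w \<noteq> 0" "\<And>u. f u \<noteq> 0 \<Longrightarrow> distinct_adj u" "\<And>u. g u \<noteq> 0 \<Longrightarrow> distinct_adj u"
  shows "distinct_adj w"
proof -
  obtain k where k: "k < length w" "f (take (Suc k) w) \<noteq> 0" "g (drop k w) \<noteq> 0"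
    using path_mult_nonzero[OF assms(1)] by blast
  have d: "distinct_adj (take (Suc k) w)" "distinct_adj (drop k w)" using k assms(2,3) by blast+
  have "w = take k w @ drop k w" by simp
  moreover have "take (Suc k) w = take k w @ [w ! k]" using k by (simp add: take_Suc_conv_app_nth)
  moreover have "hd (drop k w) = w ! k" using k by (simp add: hd_drop_conv_nth)
  ultimately show ?thesis using d by (metis distinct_adj_append_iff list.sel(1) list.distinct(1))
qed

lemma path_mult_finite:
  assumes "finite {w. f w \<noteq> 0}" "finite {w. g w \<noteq> 0}"
  shows "finite {w. path_mult f g w \<noteq> 0}"
proof (rule finite_subset)
  show "finite ((\<lambda>(u, v). u @ tl v) ` ({w. f w \<noteq> 0} \<times> {w. g w \<noteq> 0}))" using assms by simp
  show "{w. path_mult f g w \<noteq> 0} \<subseteq> (\<lambda>(u, v). u @ tl v) ` ({w. f w \<noteq> 0} \<times> {w. g w \<noteq> 0})"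
  proof
    fix w assume "w \<in> {w. path_mult f g w \<noteq> 0}"
    then obtain k where k: "k < length w" "f (take (Suc k) w) \<noteq> 0" "g (drop k w) \<noteq> 0"
      using path_mult_nonzero by blast
    moreover have "w = take (Suc k) w @ tl (drop k w)" by (metis append_take_drop_id drop_Suc tl_drop)
    ultimately show "w \<in> (\<lambda>(u, v). u @ tl v) ` ({w. f w \<noteq> 0} \<times> {w. g w \<noteq> 0})"
      by (intro image_eqI[of _ _ "(take (Suc k) w, drop k w)"]) auto
  qed
qed

lemma path_diff_distinct_adj:
  assumes "\<And>u. \<not> distinct_adj u \<Longrightarrow> f u = 0" "\<not> distinct_adj w"
  shows "path_diff f w = 0"
  using assms
proof (induction w arbitrary: f)
  case (Cons x xs)
  show ?case
  proof (cases "distinct_adj xs")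
    case False
    have "path_diff (\<lambda>u. f (x # u)) xs = 0"
      using Cons.prems(1) False by (intro Cons.IH) (auto dest: distinct_adj_ConsD)
    thus ?thesis using Cons.prems(1) False by (simp add: path_diff_Cons)
  next
    case True
    then obtain ys where ys: "xs = x # ys"
      using Cons.prems(2) by (cases xs) auto
    have "path_diff (\<lambda>u. f (x # x # u)) ys = 0"
      using Cons.prems(1) by (simp add: path_diff_def)
    thus ?thesis by (simp add: ys path_diff_Cons)
  qed
qed simp

lemma path_diff_finite:
  assumes "finite {w. f w \<noteq> 0}"
  shows "finite {w. path_diff f w \<noteq> 0}"
proof (rule finite_subset)
  let ?S = "\<Union>u\<in>{w. f w \<noteq> 0}. \<Union>k\<le>length u. range (\<lambda>y. take k u @ y # drop k u)"
  show "finite ?S" using assms by simp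
  show "{w. path_diff f w \<noteq> 0} \<subseteq> ?S"
  proof
    fix w assume "w \<in> {w. path_diff f w \<noteq> 0}"
    then obtain k where k: "k < length w" "f (take k w @ drop (Suc k) w) \<noteq> 0"
      using path_diff_nonzero by blast
    let ?u = "take k w @ drop (Suc k) w"
    have "w = take k ?u @ (w ! k) # drop k ?u" using k by (simp add: id_take_nth_drop[symmetric])
    moreover have "k \<le> length ?u" using k by simp
    ultimately show "w \<in> ?S" using k by blast
  qed
qed

instantiation uform :: ring_1
begin

lift_definition zero_uform :: uform is "\<lambda>_. 0" by (simp add: is_uform_def)
lift_definition one_uform :: uform is "\<lambda>w. if length w = 1 then 1 else 0"
proof -
  have "{w :: 3 list. length w = 1} = range (\<lambda>x. [x])" by (auto simp: length_Suc_conv)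
  thus "is_uform (\<lambda>w. if length w = 1 then 1 else 0)"
    by (auto simp: is_uform_def length_Suc_conv)
qed
lift_definition plus_uform :: "uform \<Rightarrow> uform \<Rightarrow> uform" is "\<lambda>f g w. f w + g w"
proof -
  fix f g assume a: "is_uform f" "is_uform g"
  have "{w. f w + g w \<noteq> 0} \<subseteq> {w. f w \<noteq> 0} \<union> {w. g w \<noteq> 0}" by auto
  moreover have "finite ({w. f w \<noteq> 0} \<union> {w. g w \<noteq> 0})" using a by (simp add: is_uform_def)
  ultimately have "finite {w. f w + g w \<noteq> 0}" by (rule finite_subset)
  moreover have "w \<noteq> [] \<and> distinct_adj w" if "f w + g w \<noteq> 0" for w
  proof -
    from that have "f w \<noteq> 0 \<or> g w \<noteq> 0" by auto
    thus ?thesis using a unfolding is_uform_def by blast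
  qed
  ultimately show "is_uform (\<lambda>w. f w + g w)" unfolding is_uform_def by blast
qed
lift_definition minus_uform :: "uform \<Rightarrow> uform \<Rightarrow> uform" is "\<lambda>f g w. f w - g w"
proof -
  fix f g assume a: "is_uform f" "is_uform g"
  have "{w. f w - g w \<noteq> 0} \<subseteq> {w. f w \<noteq> 0} \<union> {w. g w \<noteq> 0}" by auto
  moreover have "finite ({w. f w \<noteq> 0} \<union> {w. g w \<noteq> 0})" using a by (simp add: is_uform_def)
  ultimately have "finite {w. f w - g w \<noteq> 0}" by (rule finite_subset)
  moreover have "w \<noteq> [] \<and> distinct_adj w" if "f w - g w \<noteq> 0" for w
  proof -
    from that have "f w \<noteq> 0 \<or> g w \<noteq> 0" by auto
    thus ?thesis using a unfolding is_uform_def by blast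
  qed
  ultimately show "is_uform (\<lambda>w. f w - g w)" unfolding is_uform_def by blast
qed
lift_definition uminus_uform :: "uform \<Rightarrow> uform" is "\<lambda>f w. - f w" by (simp add: is_uform_def)
lift_definition times_uform :: "uform \<Rightarrow> uform \<Rightarrow> uform" is path_mult
proof -
  fix f g assume a: "is_uform f" "is_uform g"
  hence "finite {w. path_mult f g w \<noteq> 0}"
    unfolding is_uform_def by (blast intro: path_mult_finite)
  moreover have "distinct_adj w" if "path_mult f g w \<noteq> 0" for w
    using that by (rule path_mult_distinct_adj) (use a in \<open>simp_all add: is_uform_def\<close>)
  moreover have "w \<noteq> []" if "path_mult f g w \<noteq> 0" for w using that by auto
  ultimately show "is_uform (path_mult f g)" unfolding is_uform_def by blast
qed

instance
proof
  show "(0::uform) \<noteq> 1"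
  proof
    assume "(0::uform) = 1"
    hence "coeff_u 0 [1] = coeff_u 1 [1]" by simp
    thus False by (simp add: zero_uform.rep_eq one_uform.rep_eq)
  qed
  fix a b c :: uform
  show "1 * a = a"
    by transfer (rule path_mult_one_left, auto simp: is_uform_def)
  show "a * 1 = a"
    by transfer (rule path_mult_one_right, auto simp: is_uform_def)
  show "a * b * c = a * (b * c)"
    by transfer (simp add: fun_eq_iff path_mult_assoc)
  show "(a + b) * c = a * c + b * c" "a * (b + c) = a * b + a * c"
    by (transfer, simp add: fun_eq_iff path_mult_add_left path_mult_add_right)+
  show "a + b + c = a + (b + c)" "a + b = b + a" "0 + a = a" "- a + a = 0" "a - b = a + - b"
    by (transfer, simp add: fun_eq_iff algebra_simps)+
qed

end

definition udeg :: "nat \<Rightarrow> uform set" where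
  "udeg p = {\<omega>. \<forall>w. coeff_u \<omega> w \<noteq> 0 \<longrightarrow> length w = Suc p}"

lemma is_uform_restrict:
  assumes "is_uform f"
  shows "is_uform (\<lambda>w. if P w then f w else 0)"
proof -
  have "{w. (if P w then f w else 0) \<noteq> 0} \<subseteq> {w. f w \<noteq> 0}" by auto
  with assms have "finite {w. (if P w then f w else 0) \<noteq> 0}"
    unfolding is_uform_def by (blast intro: finite_subset)
  thus ?thesis using assms by (auto simp: is_uform_def)
qed

lift_definition ucomp :: "nat \<Rightarrow> uform \<Rightarrow> uform" is
  "\<lambda>p f w. if length w = Suc p then f w else 0"
  by (rule is_uform_restrict)

lift_definition of_alg_u :: "alg \<Rightarrow> uform" is
  "\<lambda>a w. if length w = 1 then a (hd w) else 0"
proof -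
  fix a :: alg
  have "{w :: 3 list. length w = 1} = range (\<lambda>x. [x])" by (auto simp: length_Suc_conv)
  hence "finite {w :: 3 list. length w = 1}" by simp
  moreover have "{w. (if length w = 1 then a (hd w) else 0) \<noteq> 0} \<subseteq> {w. length w = 1}" by auto
  ultimately have "finite {w. (if length w = 1 then a (hd w) else 0) \<noteq> 0}"
    using finite_subset by blast
  thus "is_uform (\<lambda>w. if length w = 1 then a (hd w) else 0)"
    by (auto simp: is_uform_def length_Suc_conv)
qed

lift_definition scale_u :: "complex \<Rightarrow> uform \<Rightarrow> uform" is "\<lambda>c f w. c * f w"
proof -
  fix c :: complex and f assume f: "is_uform f"
  have "{w. c * f w \<noteq> 0} \<subseteq> {w. f w \<noteq> 0}" by auto
  with f have "finite {w. c * f w \<noteq> 0}"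
    unfolding is_uform_def by (blast intro: finite_subset)
  thus "is_uform (\<lambda>w. c * f w)" using f by (auto simp: is_uform_def)
qed

lift_definition diff_u :: "uform \<Rightarrow> uform" is path_diff
proof -
  fix f assume f: "is_uform f"
  hence "path_diff f w = 0" if "\<not> distinct_adj w" for w
    using that by (intro path_diff_distinct_adj) (auto simp: is_uform_def)
  thus "is_uform (path_diff f)"
    using f path_diff_finite by (auto simp: is_uform_def)
qed

lift_definition star_u :: "uform \<Rightarrow> uform" is path_star
proof -
  fix f assume f: "is_uform f"
  have "{w. path_star f w \<noteq> 0} \<subseteq> rev ` {w. f w \<noteq> 0}"
    by (auto simp: path_star_def intro!: image_eqI[of _ rev "rev _"])
  moreover have "finite (rev ` {w. f w \<noteq> 0})" using f by (simp add: is_uform_def)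
  ultimately have "finite {w. path_star f w \<noteq> 0}" by (rule finite_subset)
  thus "is_uform (path_star f)"
    using f by (auto simp: is_uform_def path_star_def)
qed

section \<open>Connes forms\<close>

text \<open>On a form of degree \<open>p\<close>, \<open>a\<^sub>0 d a\<^sub>1 \<cdots> d a\<^sub>p \<mapsto> a\<^sub>0 [D, a\<^sub>1] \<cdots> [D, a\<^sub>p]\<close>: the function that
  is 1 at a list \<open>(y\<^sub>0, \<dots>, y\<^sub>p)\<close> without consecutive repetitions and 0 elsewhere is
  \<open>\<chi>(y\<^sub>0) d\<chi>(y\<^sub>1) \<cdots> d\<chi>(y\<^sub>p)\<close>. See lemma \<open>pi_u_elementary\<close> below for general \<open>a\<^sub>i\<close>.\<close>

definition pi_u :: "uform \<Rightarrow> bop" where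
  "pi_u \<omega> = (\<Sum>w | coeff_u \<omega> w \<noteq> 0. rep_alg (const_alg (coeff_u \<omega> w) * chr (hd w)) *
     prod_list (map (\<lambda>y. comm_dirac (chr y)) (tl w)))"

definition J0_deg :: "nat \<Rightarrow> uform set" where
  "J0_deg p = {\<omega> \<in> udeg p. pi_u \<omega> = 0}"

definition J0 :: "uform set" where
  "J0 = {\<omega>. \<forall>p. ucomp p \<omega> \<in> J0_deg p}"

definition connes_ideal :: "uform set" where
  "connes_ideal = {\<alpha> + diff_u \<beta> | \<alpha> \<beta>. \<alpha> \<in> J0 \<and> \<beta> \<in> J0}"

lemma block_op_add: "block_op P Q R + block_op P' Q' R' = block_op (P + P') (Q + Q') (R + R')"
  by transfer (auto simp: fun_eq_iff matrix_vector_mult_add_rdistrib)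

lemma block_op_diff: "block_op P Q R - block_op P' Q' R' = block_op (P - P') (Q - Q') (R - R')"
  by transfer (auto simp: fun_eq_iff matrix_vector_mult_diff_rdistrib)

lemma block_op_mult: "block_op P Q R * block_op P' Q' R' = block_op (P ** P') (Q ** Q') (R ** R')"
  by transfer (auto simp: fun_eq_iff matrix_vector_mul_assoc)

lemma block_op_zero: "block_op 0 0 0 = 0"
  by transfer (auto simp: fun_eq_iff zero_prod_def)

lemma block_op_one: "block_op (mat 1) (mat 1) (mat 1) = 1"
  by transfer (auto simp: fun_eq_iff)

lemma block_op_eq_iff: "block_op P Q R = block_op P' Q' R' \<longleftrightarrow> P = P' \<and> Q = Q' \<and> R = R'"
  by transfer (auto simp: fun_eq_iff matrix_eq)

lemma block_op_sum:
  "(\<Sum>x\<in>S. block_op (P x) (Q x) (R x)) = block_op (sum P S) (sum Q S) (sum R S)"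
  by (induction S rule: infinite_finite_induct) (auto simp: block_op_zero block_op_add)

definition diag_m :: "3 \<Rightarrow> 3 \<Rightarrow> alg \<Rightarrow> complex^2^2" where
  "diag_m a b f = mat22 (f a) 0 0 (f b)"

definition comm_m :: "3 \<Rightarrow> 3 \<Rightarrow> alg \<Rightarrow> complex^2^2" where
  "comm_m a b f = mat22 0 (f b - f a) (f a - f b) 0"

definition unit_m :: "3 \<Rightarrow> 3 \<Rightarrow> complex \<Rightarrow> 3 \<Rightarrow> 3 \<Rightarrow> complex^2^2" where
  "unit_m a b c x y = mat22 (if x = a \<and> y = a then c else 0) (if x = a \<and> y = b then c else 0)
     (if x = b \<and> y = a then c else 0) (if x = b \<and> y = b then c else 0)"

definition path_m :: "3 \<Rightarrow> 3 \<Rightarrow> complex \<Rightarrow> 3 list \<Rightarrow> complex^2^2" where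
  "path_m a b c w = diag_m a b (const_alg c * chr (hd w)) **
     foldr (\<lambda>y M. comm_m a b (chr y) ** M) (tl w) (mat 1)"

lemma mat22_nth [simp]:
  "mat22 a b c d $ 1 $ 1 = a" "mat22 a b c d $ 1 $ 2 = b"
  "mat22 a b c d $ 2 $ 1 = c" "mat22 a b c d $ 2 $ 2 = d"
  by (simp_all add: mat22_def)

lemma mat22_eqI:
  "P $ 1 $ 1 = Q $ 1 $ 1 \<Longrightarrow> P $ 1 $ 2 = Q $ 1 $ 2 \<Longrightarrow> P $ 2 $ 1 = Q $ 2 $ 1 \<Longrightarrow>
    P $ 2 $ 2 = Q $ 2 $ 2 \<Longrightarrow> P = (Q :: 'a^2^2)"
  by (simp add: vec_eq_iff forall_2)

lemma mat22_mult:
  "mat22 a b c d ** mat22 a' b' c' d' =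
    mat22 (a * a' + b * c') (a * b' + b * d') (c * a' + d * c') (c * b' + d * d' :: complex)"
  by (rule mat22_eqI) (simp_all add: matrix_matrix_mult_def sum_2)

lemma mat22_diff: "mat22 a b c d - mat22 a' b' c' d' =
    mat22 (a - a') (b - b') (c - c') (d - d' :: complex)"
  by (rule mat22_eqI) simp_all

lemma mat22_add: "mat22 a b c d + mat22 a' b' c' d' =
    mat22 (a + a') (b + b') (c + c') (d + d' :: complex)"
  by (rule mat22_eqI) simp_all

lemma mat22_0: "mat22 0 0 0 0 = (0 :: complex^2^2)"
  by (rule mat22_eqI) simp_all

lemma mat22_1: "mat22 1 0 0 1 = (mat 1 :: complex^2^2)"
  by (rule mat22_eqI) (simp_all add: mat_def)

lemma rep_alg_block: "rep_alg f = block_op (diag_m 1 2 f) (diag_m 2 3 f) (diag_m 1 3 f)"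
  by (simp add: rep_alg_def diag_m_def)

lemma comm_dirac_block: "comm_dirac f = block_op (comm_m 1 2 f) (comm_m 2 3 f) (comm_m 1 3 f)"
  by (simp add: comm_dirac_def dirac_def rep_alg_def comm_m_def block_op_mult block_op_diff
      mat22_mult mat22_diff)

lemma path_block:
  "rep_alg (const_alg c * chr (hd w)) * prod_list (map (\<lambda>y. comm_dirac (chr y)) (tl w)) =
    block_op (path_m 1 2 c w) (path_m 2 3 c w) (path_m 1 3 c w)"
proof -
  have "prod_list (map (\<lambda>y. comm_dirac (chr y)) ws) =
      block_op (foldr (\<lambda>y M. comm_m 1 2 (chr y) ** M) ws (mat 1))
        (foldr (\<lambda>y M. comm_m 2 3 (chr y) ** M) ws (mat 1))
        (foldr (\<lambda>y M. comm_m 1 3 (chr y) ** M) ws (mat 1))" for ws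
    by (induction ws) (simp_all add: comm_dirac_block block_op_mult block_op_one)
  thus ?thesis by (simp add: path_m_def rep_alg_block block_op_mult)
qed

lemma path_m_eq:
  assumes "a \<noteq> b" "w \<noteq> []" "distinct_adj w"
  shows "path_m a b c w = (if set w \<subseteq> {a, b} then unit_m a b c (hd w) (last w) else 0)"
  using assms(2,3)
proof (induction w arbitrary: c rule: induct_list012)
  case (2 x)
  thus ?case
    using assms(1)
    by (auto simp: path_m_def diag_m_def unit_m_def chr_def const_alg_def mat22_0)
next
  case (3 x y zs)
  let ?F = "foldr (\<lambda>y M. comm_m a b (chr y) ** M) zs (mat 1)"
  have xy: "x \<noteq> y" and IH: "path_m a b 1 (y # zs) =
      (if set (y # zs) \<subseteq> {a, b} then unit_m a b 1 y (last (y # zs)) else 0)"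
    using 3 by auto
  have "diag_m a b (const_alg c * chr x) ** comm_m a b (chr y) =
      diag_m a b (const_alg c * chr x) ** comm_m a b (chr y) ** diag_m a b (const_alg 1 * chr y)"
    using xy assms(1) by (auto simp: diag_m_def comm_m_def mat22_mult chr_def const_alg_def)
  hence "path_m a b c (x # y # zs) =
      diag_m a b (const_alg c * chr x) ** comm_m a b (chr y) ** path_m a b 1 (y # zs)"
    by (simp add: path_m_def matrix_mul_assoc)
  also have "\<dots> = (if set (x # y # zs) \<subseteq> {a, b} then unit_m a b c x (last (y # zs)) else 0)"
    unfolding IH diag_m_def comm_m_def unit_m_def
    using xy assms(1) by (auto simp: mat22_mult mat22_0 chr_def const_alg_def)
  finally show ?case by simp
qed simp_all

lemma alternating_unique:
  assumes "distinct_adj u" "distinct_adj v" "length u = length v" "u \<noteq> []" "hd u = hd v"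
    "set u \<union> set v \<subseteq> {a, b}"
  shows "u = v"
  using assms(3,1,2,4-)
proof (induction u v rule: list_induct2)
  case (Cons x xs y ys)
  show ?case
  proof (cases xs)
    case Nil
    thus ?thesis using Cons by simp
  next
    case (Cons x' xs')
    then obtain y' ys' where ys: "ys = y' # ys'" using Cons.hyps by (cases ys) auto
    have "x' = y'" using Cons.prems unfolding Cons ys by auto
    hence "xs = ys" using Cons.IH Cons.prems unfolding Cons ys by auto
    thus ?thesis using Cons.prems by simp
  qed
qed simp

lemma finite_coeff_u: "finite {w. coeff_u \<omega> w \<noteq> 0}"
  using coeff_u[of \<omega>] by (simp add: is_uform_def)

lemma coeff_u_path: "coeff_u \<omega> w \<noteq> 0 \<Longrightarrow> w \<noteq> [] \<and> distinct_adj w"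
  using coeff_u[of \<omega>] by (simp add: is_uform_def)

lemma few_points:
  "card (set (w :: 3 list)) \<le> 2 \<longleftrightarrow> set w \<subseteq> {1, 2} \<or> set w \<subseteq> {2, 3} \<or> set w \<subseteq> {1, 3}"
proof
  assume "card (set w) \<le> 2"
  hence "set w \<noteq> UNIV" by auto
  then obtain z where "z \<notin> set w" by auto
  hence sub: "set w \<subseteq> {1, 2, 3} - {z}" using UNIV_3 by auto
  show "set w \<subseteq> {1, 2} \<or> set w \<subseteq> {2, 3} \<or> set w \<subseteq> {1, 3}"
    using exhaust_3[of z] sub by (elim disjE) auto
next
  have c: "card (set w) \<le> 2" if "set w \<subseteq> {x, y}" for x y
  proof -
    have "card (set w) \<le> card {x, y}" using that by (intro card_mono) auto
    also have "\<dots> \<le> 2" by (simp add: card_insert_if)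
    finally show ?thesis .
  qed
  assume "set w \<subseteq> {1, 2} \<or> set w \<subseteq> {2, 3} \<or> set w \<subseteq> {1, 3}"
  thus "card (set w) \<le> 2" by (elim disjE) (rule c, assumption)+
qed

lemma pi_u_eq_0_iff:
  assumes "\<omega> \<in> udeg p"
  shows "pi_u \<omega> = 0 \<longleftrightarrow> (\<forall>w. card (set w) \<le> 2 \<longrightarrow> coeff_u \<omega> w = 0)"
proof -
  define S where "S = {w. coeff_u \<omega> w \<noteq> 0}"
  define M where "M a b = (\<Sum>w\<in>S. path_m a b (coeff_u \<omega> w) w)" for a b
  have fin: "finite S" by (simp add: S_def finite_coeff_u)
  have "pi_u \<omega> = block_op (M 1 2) (M 2 3) (M 1 3)"
    by (simp add: pi_u_def path_block block_op_sum M_def S_def)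
  hence eq: "pi_u \<omega> = 0 \<longleftrightarrow> M 1 2 = 0 \<and> M 2 3 = 0 \<and> M 1 3 = 0"
    by (simp add: block_op_zero[symmetric] block_op_eq_iff)
  have S: "w \<noteq> []" "distinct_adj w" "length w = Suc p" if "w \<in> S" for w
    using that assms coeff_u_path[of \<omega> w] by (auto simp: S_def udeg_def)
  have M: "M a b = 0 \<longleftrightarrow> (\<forall>w. set w \<subseteq> {a, b} \<longrightarrow> coeff_u \<omega> w = 0)" if ab: "a \<noteq> b" for a b
  proof -
    have M': "M a b = (\<Sum>w\<in>S. if set w \<subseteq> {a, b} then unit_m a b (coeff_u \<omega> w) (hd w) (last w) else 0)"
      unfolding M_def using S ab by (intro sum.cong refl path_m_eq) auto
    show ?thesis
    proof
      assume 0: "\<forall>w. set w \<subseteq> {a, b} \<longrightarrow> coeff_u \<omega> w = 0"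
      show "M a b = 0" unfolding M' by (rule sum.neutral) (use 0 in \<open>auto simp: S_def\<close>)
    next
      assume 0: "M a b = 0"
      show "\<forall>w. set w \<subseteq> {a, b} \<longrightarrow> coeff_u \<omega> w = 0"
      proof (rule ccontr)
        assume "\<not> ?thesis"
        then obtain w where w: "set w \<subseteq> {a, b}" "w \<in> S" by (auto simp: S_def)
        define r s where "r = (if hd w = a then 1 else 2 :: 2)" and "s = (if last w = a then 1 else 2 :: 2)"
        have hl: "hd w \<in> {a, b}" "last w \<in> {a, b}"
          using w S[OF w(2)] hd_in_set last_in_set by blast+
        have u: "unit_m a b c (hd w) (last w) $ r $ s = c" for c
          using hl ab by (auto simp: unit_m_def r_def s_def)
        have z: "unit_m a b c x y $ r $ s = 0" if "x \<noteq> hd w" for c x y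
          using that hl ab by (auto simp: unit_m_def r_def s_def)
        have "M a b $ r $ s = (\<Sum>v\<in>S. if v = w then coeff_u \<omega> w else 0)"
          unfolding M' sum_component
        proof (rule sum.cong)
          fix v assume v: "v \<in> S"
          show "(if set v \<subseteq> {a, b} then unit_m a b (coeff_u \<omega> v) (hd v) (last v) else 0) $ r $ s =
              (if v = w then coeff_u \<omega> w else 0)"
          proof (cases "v = w")
            case True
            thus ?thesis using w u by simp
          next
            case False
            have "hd v \<noteq> hd w" if "set v \<subseteq> {a, b}"
              using alternating_unique[of v w a b] S[OF v] S[OF w(2)] w that False by auto
            thus ?thesis using False z by simp
          qed
        qed simp
        also have "\<dots> = coeff_u \<omega> w" using fin w by simp
        finally show False using 0 w by (simp add: S_def)
      qed
    qed
  qed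
  show ?thesis unfolding eq few_points by (simp add: M) blast
qed

lemma J0_iff: "\<omega> \<in> J0 \<longleftrightarrow> (\<forall>w. card (set w) \<le> 2 \<longrightarrow> coeff_u \<omega> w = 0)"
proof -
  have d: "ucomp p \<omega> \<in> udeg p" for p by (simp add: udeg_def ucomp.rep_eq)
  have "\<omega> \<in> J0 \<longleftrightarrow> (\<forall>p w. card (set w) \<le> 2 \<longrightarrow> coeff_u (ucomp p \<omega>) w = 0)"
    using pi_u_eq_0_iff[OF d] d by (simp add: J0_def J0_deg_def)
  also have "\<dots> \<longleftrightarrow> (\<forall>w. card (set w) \<le> 2 \<longrightarrow> coeff_u \<omega> w = 0)"
  proof -
    have "coeff_u \<omega> w = 0 \<longleftrightarrow> (\<forall>p. coeff_u (ucomp p \<omega>) w = 0)" for w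
      using coeff_u_path[of \<omega> w] by (cases w) (auto simp: ucomp.rep_eq)
    thus ?thesis by blast
  qed
  finally show ?thesis .
qed

lemma card_set_le:
  assumes "set u \<subseteq> set w" "card (set w) \<le> 2" shows "card (set u) \<le> 2"
  using assms card_mono[OF finite_set assms(1)] by linarith

lemma diff_u_J0: "\<omega> \<in> J0 \<Longrightarrow> diff_u \<omega> \<in> J0"
  unfolding J0_iff diff_u.rep_eq
proof (intro allI impI, rule ccontr)
  fix w assume 0: "\<forall>w. card (set w) \<le> 2 \<longrightarrow> coeff_u \<omega> w = 0" "card (set w) \<le> 2"
    "path_diff (coeff_u \<omega>) w \<noteq> 0"
  then obtain k where "coeff_u \<omega> (take k w @ drop (Suc k) w) \<noteq> 0"
    using path_diff_nonzero by blast
  moreover have "set (take k w @ drop (Suc k) w) \<subseteq> set w"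
    using set_take_subset set_drop_subset by (auto dest: in_set_takeD in_set_dropD)
  ultimately show False using 0 card_set_le by blast
qed

lemma times_J0: 
  assumes "\<alpha> \<in> J0 \<or> \<beta> \<in> J0"
  shows "\<alpha> * \<beta> \<in> J0"
  unfolding J0_iff times_uform.rep_eq
proof (intro allI impI, rule ccontr)
  fix w assume 0: "card (set w) \<le> 2" "path_mult (coeff_u \<alpha>) (coeff_u \<beta>) w \<noteq> 0"
  then obtain k where "coeff_u \<alpha> (take (Suc k) w) \<noteq> 0" "coeff_u \<beta> (drop k w) \<noteq> 0"
    using path_mult_nonzero by blast
  moreover have "set (take (Suc k) w) \<subseteq> set w" "set (drop k w) \<subseteq> set w"
    by (rule set_take_subset, rule set_drop_subset)
  ultimately show False using 0 card_set_le assms unfolding J0_iff by blast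
qed

lemma J0_zero: "0 \<in> J0" by (simp add: J0_iff zero_uform.rep_eq)
lemma J0_add: "\<alpha> \<in> J0 \<Longrightarrow> \<beta> \<in> J0 \<Longrightarrow> \<alpha> + \<beta> \<in> J0" by (simp add: J0_iff plus_uform.rep_eq)
lemma J0_minus: "\<alpha> \<in> J0 \<Longrightarrow> - \<alpha> \<in> J0" by (simp add: J0_iff uminus_uform.rep_eq)
lemma J0_diff: "\<alpha> \<in> J0 \<Longrightarrow> \<beta> \<in> J0 \<Longrightarrow> \<alpha> - \<beta> \<in> J0" by (simp add: J0_iff minus_uform.rep_eq)
lemma J0_scale: "\<alpha> \<in> J0 \<Longrightarrow> scale_u c \<alpha> \<in> J0" by (simp add: J0_iff scale_u.rep_eq)
lemma J0_star: "\<alpha> \<in> J0 \<Longrightarrow> star_u \<alpha> \<in> J0"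
  by (simp add: J0_iff star_u.rep_eq path_star_def)

lemma diff_u_diff: "diff_u (\<alpha> - \<beta>) = diff_u \<alpha> - diff_u \<beta>"
  by transfer (simp add: fun_eq_iff path_diff_diff)

lemma connes_ideal_eq_J0: "connes_ideal = J0"
proof
  show "connes_ideal \<subseteq> J0" by (auto simp: connes_ideal_def intro: J0_add diff_u_J0)
  have "diff_u 0 = 0" by transfer (simp add: fun_eq_iff path_diff_def)
  hence "\<alpha> = \<alpha> + diff_u 0" for \<alpha> by simp
  thus "J0 \<subseteq> connes_ideal" unfolding connes_ideal_def using J0_zero by blast
qed

text \<open>The quotient \<open>\<Omega>\<close>, with the product \<open>\<and>\<close> as ring multiplication.\<close>

definition connes_rel :: "uform \<Rightarrow> uform \<Rightarrow> bool" where
  "connes_rel \<alpha> \<beta> \<longleftrightarrow> \<alpha> - \<beta> \<in> connes_ideal"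

quotient_type form = uform / connes_rel
proof (rule equivpI)
  show "reflp connes_rel" by (simp add: reflp_def connes_rel_def connes_ideal_eq_J0 J0_zero)
  show "symp connes_rel"
    unfolding symp_def connes_rel_def connes_ideal_eq_J0 by (metis J0_minus minus_diff_eq)
  show "transp connes_rel"
    unfolding transp_def connes_rel_def connes_ideal_eq_J0
    by (metis J0_add add_diff_eq diff_add_cancel)
qed

instantiation form :: ring_1
begin

lift_definition zero_form :: form is 0 .
lift_definition one_form :: form is 1 .
lift_definition plus_form :: "form \<Rightarrow> form \<Rightarrow> form" is "(+)"
  unfolding connes_rel_def connes_ideal_eq_J0 by (metis J0_add add_diff_add)
lift_definition minus_form :: "form \<Rightarrow> form \<Rightarrow> form" is "(-)"
  unfolding connes_rel_def connes_ideal_eq_J0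
  by (drule (1) J0_diff) (simp add: algebra_simps)
lift_definition uminus_form :: "form \<Rightarrow> form" is uminus
  unfolding connes_rel_def connes_ideal_eq_J0
  by (drule J0_minus) (simp add: algebra_simps)
lift_definition times_form :: "form \<Rightarrow> form \<Rightarrow> form" is "(*)"
proof -
  fix \<alpha> \<alpha>' \<beta> \<beta>' assume "connes_rel \<alpha> \<alpha>'" "connes_rel \<beta> \<beta>'"
  hence "\<alpha> * (\<beta> - \<beta>') + (\<alpha> - \<alpha>') * \<beta>' \<in> J0"
    unfolding connes_rel_def connes_ideal_eq_J0 by (intro J0_add times_J0) auto
  thus "connes_rel (\<alpha> * \<beta>) (\<alpha>' * \<beta>')"
    unfolding connes_rel_def connes_ideal_eq_J0 by (simp add: algebra_simps)
qed

instance
proof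
  fix a b c :: form
  show "a * b * c = a * (b * c)"
    by transfer (simp add: connes_rel_def connes_ideal_eq_J0 J0_zero mult.assoc)
  show "1 * a = a" "a * 1 = a" "0 + a = a" "- a + a = 0"
    by (transfer, simp add: connes_rel_def connes_ideal_eq_J0 J0_zero)+
  show "(a + b) * c = a * c + b * c" "a * (b + c) = a * b + a * c" "a + b + c = a + (b + c)"
    "a + b = b + a" "a - b = a + - b"
    by (transfer, simp add: connes_rel_def connes_ideal_eq_J0 J0_zero algebra_simps)+
  show "(0::form) \<noteq> 1"
  proof (transfer, unfold connes_rel_def connes_ideal_eq_J0 J0_iff, rule notI)
    assume "\<forall>w. card (set w) \<le> 2 \<longrightarrow> coeff_u (0 - 1) w = 0"
    hence "card (set [1 :: 3]) \<le> 2 \<longrightarrow> coeff_u (0 - 1) [1 :: 3] = 0" by blast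
    thus False by (simp add: uminus_uform.rep_eq one_uform.rep_eq)
  qed
qed

end

text \<open>The embedding of \<open>A = \<Omega>\<^sup>0\<close> and the operations induced on the quotient.\<close>

lift_definition of_alg :: "alg \<Rightarrow> form" is of_alg_u .

lift_definition scale :: "complex \<Rightarrow> form \<Rightarrow> form" is scale_u
proof -
  fix c \<alpha> \<beta> assume "connes_rel \<alpha> \<beta>"
  moreover have "scale_u c (\<alpha> - \<beta>) = scale_u c \<alpha> - scale_u c \<beta>"
    by transfer (simp add: fun_eq_iff algebra_simps)
  ultimately show "connes_rel (scale_u c \<alpha>) (scale_u c \<beta>)"
    unfolding connes_rel_def connes_ideal_eq_J0 by (metis J0_scale)
qed

lift_definition diff :: "form \<Rightarrow> form" is diff_u
  unfolding connes_rel_def connes_ideal_eq_J0 by (metis diff_u_J0 diff_u_diff)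

lift_definition star :: "form \<Rightarrow> form" is star_u
proof -
  fix \<alpha> \<beta> assume "connes_rel \<alpha> \<beta>"
  moreover have "star_u (\<alpha> - \<beta>) = star_u \<alpha> - star_u \<beta>"
    by transfer (simp add: fun_eq_iff path_star_def algebra_simps)
  ultimately show "connes_rel (star_u \<alpha>) (star_u \<beta>)"
    unfolding connes_rel_def connes_ideal_eq_J0 by (metis J0_star)
qed

definition Omega :: "nat \<Rightarrow> form set" where
  "Omega n = abs_form ` udeg n"

section \<open>The universal property of the model, and the representation\<close>

lift_definition word_u :: "complex \<Rightarrow> 3 list \<Rightarrow> uform" is
  "\<lambda>c w v. if v = w \<and> w \<noteq> [] \<and> distinct_adj w then c else 0"
proof -
  fix c :: complex and w :: "3 list"
  have "{v. (if v = w \<and> w \<noteq> [] \<and> distinct_adj w then c else 0) \<noteq> 0} \<subseteq> {w}" by auto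
  hence "finite {v. (if v = w \<and> w \<noteq> [] \<and> distinct_adj w then c else 0) \<noteq> 0}"
    using finite_subset by blast
  thus "is_uform (\<lambda>v. if v = w \<and> w \<noteq> [] \<and> distinct_adj w then c else 0)"
    by (auto simp: is_uform_def)
qed

lemma coeff_u_eqI: "(\<And>w. w \<noteq> [] \<Longrightarrow> distinct_adj w \<Longrightarrow> coeff_u \<alpha> w = coeff_u \<beta> w) \<Longrightarrow> \<alpha> = \<beta>"
  by (rule coeff_u_inject[THEN iffD1], rule ext) (metis coeff_u_path)

lemma coeff_u_sum: "coeff_u (sum f S) w = (\<Sum>x\<in>S. coeff_u (f x) w)"
  by (induction S rule: infinite_finite_induct)
    (auto simp: zero_uform.rep_eq plus_uform.rep_eq)

lemma uform_eq_sum_words: "\<omega> = (\<Sum>w | coeff_u \<omega> w \<noteq> 0. word_u (coeff_u \<omega> w) w)"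
proof (rule coeff_u_eqI)
  fix v :: "3 list" assume v: "v \<noteq> []" "distinct_adj v"
  have "coeff_u (\<Sum>w | coeff_u \<omega> w \<noteq> 0. word_u (coeff_u \<omega> w) w) v =
      (\<Sum>w | coeff_u \<omega> w \<noteq> 0. if w = v then coeff_u \<omega> v else 0)"
    unfolding coeff_u_sum using v by (intro sum.cong refl) (auto simp: word_u.rep_eq)
  also have "\<dots> = coeff_u \<omega> v" using finite_coeff_u[of \<omega>] by simp
  finally show "coeff_u \<omega> v = coeff_u (\<Sum>w | coeff_u \<omega> w \<noteq> 0. word_u (coeff_u \<omega> w) w) v" ..
qed

lemma uform_induct [case_names zero add]:
  assumes "P 0" "\<And>c w \<omega>. w \<noteq> [] \<Longrightarrow> distinct_adj w \<Longrightarrow> P \<omega> \<Longrightarrow> P (word_u c w + \<omega>)"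
  shows "P \<omega>"
proof -
  have "P (\<Sum>w\<in>S. word_u (f w) w)" if "finite S" "\<And>w. w \<in> S \<Longrightarrow> w \<noteq> [] \<and> distinct_adj w" for S f
    using that by (induction S rule: finite_induct) (auto intro: assms)
  from this[of "{w. coeff_u \<omega> w \<noteq> 0}" "coeff_u \<omega>"] show ?thesis
    using finite_coeff_u coeff_u_path by (simp flip: uform_eq_sum_words)
qed

lemma word_u_times:
  assumes "u \<noteq> []" "distinct_adj u" "v \<noteq> []" "distinct_adj v"
  shows "word_u c u * word_u d v = (if last u = hd v then word_u (c * d) (u @ tl v) else 0)"
proof (rule coeff_u_eqI)
  fix w :: "3 list" assume w: "w \<noteq> []" "distinct_adj w"
  have *: "take (Suc k) w = u \<and> drop k w = v \<longleftrightarrow> k = length u - 1 \<and> last u = hd v \<and> w = u @ tl v"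
    if "k < length w" for k
  proof
    assume a: "take (Suc k) w = u \<and> drop k w = v"
    have "w = take (Suc k) w @ tl (drop k w)"
      by (metis append_take_drop_id drop_Suc tl_drop)
    moreover have "length u = Suc k" using a that by auto
    moreover have "last u = w ! k" using a that by (auto simp: take_Suc_conv_app_nth)
    moreover have "hd v = w ! k" using a that by (auto simp: hd_drop_conv_nth)
    ultimately show "k = length u - 1 \<and> last u = hd v \<and> w = u @ tl v" using a by simp
  next
    assume a: "k = length u - 1 \<and> last u = hd v \<and> w = u @ tl v"
    hence l: "Suc k = length u" using assms by (cases u) auto
    have "drop k u = [last u]"
      using a assms by (metis append_butlast_last_id append_eq_conv_conj length_butlast)
    thus "take (Suc k) w = u \<and> drop k w = v"
      using a l assms by (cases v) auto
  qed
  have "coeff_u (word_u c u * word_u d v) w =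
      (\<Sum>k<length w. if k = length u - 1 then if last u = hd v \<and> w = u @ tl v then c * d else 0 else 0)"
    unfolding times_uform.rep_eq path_mult_def
  proof (rule sum.cong)
    fix k assume k: "k \<in> {..<length w}"
    have "coeff_u (word_u c u) (take (Suc k) w) * coeff_u (word_u d v) (drop k w) =
        (if take (Suc k) w = u \<and> drop k w = v then c * d else 0)"
      using assms by (simp add: word_u.rep_eq)
    also have "\<dots> = (if k = length u - 1 \<and> last u = hd v \<and> w = u @ tl v then c * d else 0)"
      using * k by simp
    finally show "coeff_u (word_u c u) (take (Suc k) w) * coeff_u (word_u d v) (drop k w) =
        (if k = length u - 1 then if last u = hd v \<and> w = u @ tl v then c * d else 0 else 0)"
      by simp
  qed simp
  also have "\<dots> = (if last u = hd v \<and> w = u @ tl v then c * d else 0)"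
    using assms(1) by (cases u) auto
  also have "\<dots> = coeff_u (if last u = hd v then word_u (c * d) (u @ tl v) else 0) w"
    using w by (auto simp: word_u.rep_eq zero_uform.rep_eq)
  finally show "coeff_u (word_u c u * word_u d v) w =
      coeff_u (if last u = hd v then word_u (c * d) (u @ tl v) else 0) w" .
qed

lemma distinct_adj_glue:
  assumes "u \<noteq> []" "distinct_adj u" "v \<noteq> []" "distinct_adj v" "last u = hd v"
  shows "distinct_adj (u @ tl v)"
proof -
  obtain x xs where v: "v = x # xs" using assms(3) by (cases v) auto
  show ?thesis
  proof (cases "xs = []")
    case False
    thus ?thesis using assms unfolding v distinct_adj_append_iff
      by (metis distinct_adj_Cons list.sel(1,3))
  qed (use assms v in simp)
qed

lemma word_sum_add:
  fixes T :: "complex \<Rightarrow> 3 list \<Rightarrow> 'b::ab_group_add"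
  assumes T: "\<And>c d w. T (c + d) w = T c w + T d w"
  defines "F \<equiv> \<lambda>\<omega>. \<Sum>w | coeff_u \<omega> w \<noteq> 0. T (coeff_u \<omega> w) w"
  shows "F (\<alpha> + \<beta>) = F \<alpha> + F \<beta>"
    and "w \<noteq> [] \<Longrightarrow> distinct_adj w \<Longrightarrow> F (word_u c w) = T c w"
    and "finite S \<Longrightarrow> {w. coeff_u \<omega> w \<noteq> 0} \<subseteq> S \<Longrightarrow> F \<omega> = (\<Sum>w\<in>S. T (coeff_u \<omega> w) w)"
proof -
  have T0: "T 0 w = 0" for w using T[of 0 0 w] by simp
  have big: "F \<omega> = (\<Sum>w\<in>S. T (coeff_u \<omega> w) w)" if "finite S" "{w. coeff_u \<omega> w \<noteq> 0} \<subseteq> S" for S \<omega>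
    unfolding F_def using that by (intro sum.mono_neutral_left) (auto simp: T0)
  let ?S = "{w. coeff_u \<alpha> w \<noteq> 0} \<union> {w. coeff_u \<beta> w \<noteq> 0}"
  have fin: "finite ?S" using finite_coeff_u by simp
  have "{w. coeff_u (\<alpha> + \<beta>) w \<noteq> 0} \<subseteq> ?S" by (auto simp: plus_uform.rep_eq)
  thus "F (\<alpha> + \<beta>) = F \<alpha> + F \<beta>"
    using big[OF fin, of "\<alpha> + \<beta>"] big[OF fin, of \<alpha>] big[OF fin, of \<beta>]
    by (simp add: plus_uform.rep_eq T sum.distrib)
  show "F (word_u c w) = T c w" if "w \<noteq> []" "distinct_adj w"
    using that by (subst big[of "{w}"]) (auto simp: word_u.rep_eq)
  show "finite S \<Longrightarrow> {w. coeff_u \<omega> w \<noteq> 0} \<subseteq> S \<Longrightarrow> F \<omega> = (\<Sum>w\<in>S. T (coeff_u \<omega> w) w)"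
    by (rule big)
qed

lemma multiplicative_if_on_words:
  fixes F :: "uform \<Rightarrow> 'b::ring_1"
  assumes add: "\<And>\<alpha> \<beta>. F (\<alpha> + \<beta>) = F \<alpha> + F \<beta>"
    and words: "\<And>c u d v. u \<noteq> [] \<Longrightarrow> distinct_adj u \<Longrightarrow> v \<noteq> [] \<Longrightarrow> distinct_adj v \<Longrightarrow>
      F (word_u c u * word_u d v) = F (word_u c u) * F (word_u d v)"
  shows "F (\<alpha> * \<beta>) = F \<alpha> * F \<beta>"
proof -
  have 0: "F 0 = 0" using add[of 0 0] by simp
  have 1: "F (word_u c u * \<beta>) = F (word_u c u) * F \<beta>" if "u \<noteq> []" "distinct_adj u" for c u \<beta>
    by (induction \<beta> rule: uform_induct) (use that in \<open>auto simp: 0 add words distrib_left\<close>)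
  show ?thesis
    by (induction \<alpha> rule: uform_induct) (auto simp: 0 add 1 distrib_right)
qed

lemma of_alg_u_eq_sum: "of_alg_u a = (\<Sum>x\<in>UNIV. word_u (a x) [x])"
proof (rule coeff_u_eqI)
  fix w :: "3 list" assume w: "w \<noteq> []" "distinct_adj w"
  have "coeff_u (\<Sum>x\<in>UNIV. word_u (a x) [x]) w = (\<Sum>x\<in>UNIV. if x = hd w \<and> w = [hd w] then a (hd w) else 0)"
    unfolding coeff_u_sum by (intro sum.cong) (auto simp: word_u.rep_eq)
  also have "\<dots> = (if w = [hd w] then a (hd w) else 0)" by simp
  also have "\<dots> = coeff_u (of_alg_u a) w" using w by (cases w) (auto simp: of_alg_u.rep_eq)
  finally show "coeff_u (of_alg_u a) w = coeff_u (\<Sum>x\<in>UNIV. word_u (a x) [x]) w" ..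
qed

lemma of_alg_u_times_word:
  assumes "w \<noteq> []" "distinct_adj w"
  shows "of_alg_u a * word_u c w = word_u (a (hd w) * c) w"
    and "word_u c w * of_alg_u a = word_u (c * a (last w)) w"
proof -
  have "of_alg_u a * word_u c w = (\<Sum>x\<in>UNIV. if x = hd w then word_u (a (hd w) * c) w else 0)"
    unfolding of_alg_u_eq_sum sum_distrib_right
    using assms by (intro sum.cong refl) (auto simp: word_u_times)
  thus "of_alg_u a * word_u c w = word_u (a (hd w) * c) w" by simp
  have "word_u c w * of_alg_u a = (\<Sum>x\<in>UNIV. if x = last w then word_u (c * a (last w)) w else 0)"
    unfolding of_alg_u_eq_sum sum_distrib_left
    using assms by (intro sum.cong refl) (auto simp: word_u_times)
  thus "word_u c w * of_alg_u a = word_u (c * a (last w)) w" by simp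
qed

lemma of_alg_u_hom:
  "of_alg_u 1 = 1" "of_alg_u (a + b) = of_alg_u a + of_alg_u b" "of_alg_u (a * b) = of_alg_u a * of_alg_u b"
proof -
  show "of_alg_u 1 = 1" by transfer (auto simp: fun_eq_iff)
  show "of_alg_u (a + b) = of_alg_u a + of_alg_u b" by transfer (auto simp: fun_eq_iff)
  show "of_alg_u (a * b) = of_alg_u a * of_alg_u b"
    unfolding of_alg_u_eq_sum[of b] of_alg_u_eq_sum[of "a * b"] sum_distrib_left
    by (simp add: of_alg_u_times_word)
qed

lemma word_u_add: "word_u (c + d) w = word_u c w + word_u d w"
  by transfer (auto simp: fun_eq_iff)

lemma word_u_deg: "word_u c [x, y] \<in> udeg 1"
  by (auto simp: udeg_def word_u.rep_eq split: if_splits)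

lemma udeg_1_eq_sum:
  assumes "m \<in> udeg 1"
  shows "m = (\<Sum>w | coeff_u m w \<noteq> 0. word_u (coeff_u m w) [hd w, last w])"
proof -
  have "w = [hd w, last w]" if "coeff_u m w \<noteq> 0" for w
    using that assms by (auto simp: udeg_def length_Suc_conv)
  hence "(\<Sum>w | coeff_u m w \<noteq> 0. word_u (coeff_u m w) w) =
      (\<Sum>w | coeff_u m w \<noteq> 0. word_u (coeff_u m w) [hd w, last w])"
    by (intro sum.cong refl) auto
  thus ?thesis using uform_eq_sum_words by metis
qed

lemma udeg_iff: "\<omega> \<in> udeg p \<longleftrightarrow> (\<forall>w. length w \<noteq> Suc p \<longrightarrow> coeff_u \<omega> w = 0)"
  by (auto simp: udeg_def)

lemma udeg_add: "\<alpha> \<in> udeg p \<Longrightarrow> \<beta> \<in> udeg p \<Longrightarrow> \<alpha> + \<beta> \<in> udeg p"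
  unfolding udeg_iff by (simp add: plus_uform.rep_eq)

lemma udeg_zero: "0 \<in> udeg p"
  by (simp add: udeg_def zero_uform.rep_eq)

lemma udeg_sum: "(\<And>x. x \<in> S \<Longrightarrow> f x \<in> udeg p) \<Longrightarrow> sum f S \<in> udeg p"
  by (induction S rule: infinite_finite_induct) (auto intro: udeg_add udeg_zero)

text \<open>Ring homomorphisms from \<open>\<Omega>\<^sub>u A\<close> to a ring \<open>B\<close> correspond to pairs of a ring homomorphism
  \<open>\<phi> : A \<rightarrow> B\<close> and an \<open>A\<close>-bimodule map \<open>\<psi> : \<Omega>\<^sup>1\<^sub>u A \<rightarrow> B\<close>.\<close>

lemma uform_universal:
  fixes \<phi> :: "alg \<Rightarrow> 'b::ring_1" and \<psi> :: "uform \<Rightarrow> 'b"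
  assumes \<phi>: "\<phi> 1 = 1" "\<And>a b. \<phi> (a + b) = \<phi> a + \<phi> b" "\<And>a b. \<phi> (a * b) = \<phi> a * \<phi> b"
    and \<psi>: "\<And>m n. m \<in> udeg 1 \<Longrightarrow> n \<in> udeg 1 \<Longrightarrow> \<psi> (m + n) = \<psi> m + \<psi> n"
      "\<And>a m. m \<in> udeg 1 \<Longrightarrow> \<psi> (of_alg_u a * m) = \<phi> a * \<psi> m"
      "\<And>a m. m \<in> udeg 1 \<Longrightarrow> \<psi> (m * of_alg_u a) = \<psi> m * \<phi> a"
  shows "\<exists>!\<Phi>. (\<forall>\<alpha> \<beta>. \<Phi> (\<alpha> + \<beta>) = \<Phi> \<alpha> + \<Phi> \<beta>) \<and> (\<forall>\<alpha> \<beta>. \<Phi> (\<alpha> * \<beta>) = \<Phi> \<alpha> * \<Phi> \<beta>) \<and>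
    (\<forall>a. \<Phi> (of_alg_u a) = \<phi> a) \<and> (\<forall>m\<in>udeg 1. \<Phi> m = \<psi> m)"
proof -
  define k where "k c = \<phi> (const_alg c)" for c
  define P where "P w = prod_list (map2 (\<lambda>x y. \<psi> (word_u 1 [x, y])) w (tl w))" for w
  define T where "T c w = k c * (\<phi> (chr (hd w)) * P w)" for c w
  define F where "F \<omega> = (\<Sum>w | coeff_u \<omega> w \<noteq> 0. T (coeff_u \<omega> w) w)" for \<omega>
  have P1: "P [x] = 1" and P2: "P (x # y # zs) = \<psi> (word_u 1 [x, y]) * P (y # zs)" for x y zs
    by (simp_all add: P_def)
  have k_add: "k (c + d) = k c + k d" for c d
    by (simp add: k_def \<phi>(2)[symmetric]) (simp add: const_alg_def plus_fun_def)
  have k_mult: "k (c * d) = k c * k d" for c d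
    by (simp add: k_def \<phi>(3)[symmetric]) (simp add: const_alg_def times_fun_def)
  have k1: "k 1 = 1" using \<phi>(1) by (simp add: k_def const_alg_def one_fun_def)
  have k0: "k 0 = 0" using k_add[of 0 0] by simp
  have k_comm: "k c * \<phi> a = \<phi> a * k c" for c a
    by (simp add: k_def \<phi>(3)[symmetric] mult.commute)
  have psi_word: "\<psi> (word_u c [x, y]) = k c * \<psi> (word_u 1 [x, y])" if "x \<noteq> y" for c x y
    using \<psi>(2)[OF word_u_deg, of "const_alg c" 1 x y] that
    by (simp add: of_alg_u_times_word k_def const_alg_def)
  have psi_right: "\<psi> (word_u 1 [x, y]) * \<phi> a = k (a y) * \<psi> (word_u 1 [x, y])" if "x \<noteq> y" for x y a
    using \<psi>(3)[OF word_u_deg, of 1 x y a] psi_word[OF that, of "a y"] that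
    by (simp add: of_alg_u_times_word)
  have Q_right: "\<phi> (chr (hd w)) * P w * \<phi> a = k (a (last w)) * (\<phi> (chr (hd w)) * P w)"
    if "w \<noteq> []" "distinct_adj w" for w a
    using that
  proof (induction w rule: induct_list012)
    case (2 x)
    have "chr x * a = const_alg (a x) * chr x"
      by (auto simp: chr_def const_alg_def fun_eq_iff)
    thus ?case by (simp add: P1 k_def \<phi>(3)[symmetric])
  next
    case (3 x y zs)
    have xy: "x \<noteq> y" using 3 by simp
    have "\<psi> (word_u 1 [x, y]) * \<phi> (chr y) = \<psi> (word_u 1 [x, y])"
      using psi_right[OF xy] by (simp add: chr_def k1)
    hence R: "P (x # y # zs) = \<psi> (word_u 1 [x, y]) * (\<phi> (chr y) * P (y # zs))"
      unfolding P2 by (metis mult.assoc)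
    have IH: "\<phi> (chr y) * P (y # zs) * \<phi> a = k (a (last (y # zs))) * (\<phi> (chr y) * P (y # zs))"
      using 3 by simp
    have "P (x # y # zs) * \<phi> a = \<psi> (word_u 1 [x, y]) * k (a (last (y # zs))) * (\<phi> (chr y) * P (y # zs))"
      unfolding R using IH by (simp only: mult.assoc)
    also have "\<psi> (word_u 1 [x, y]) * k (a (last (y # zs))) = k (a (last (y # zs))) * \<psi> (word_u 1 [x, y])"
      using psi_right[OF xy, of "const_alg (a (last (y # zs)))"] by (simp add: k_def const_alg_def)
    finally have "P (x # y # zs) * \<phi> a = k (a (last (y # zs))) * P (x # y # zs)"
      unfolding R by (simp only: mult.assoc)
    hence "\<phi> (chr x) * P (x # y # zs) * \<phi> a = \<phi> (chr x) * k (a (last (y # zs))) * P (x # y # zs)"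
      by (simp only: mult.assoc)
    thus ?case by (simp add: k_comm[symmetric] mult.assoc)
  qed simp_all
  have P_glue: "P (u @ tl v) = P u * P v" if "u \<noteq> []" "v \<noteq> []" "last u = hd v" for u v
    using that
  proof (induction u rule: induct_list012)
    case (2 x)
    thus ?case by (cases v) (simp_all add: P1)
  next
    case (3 x y zs)
    thus ?case by (simp add: P2 mult.assoc)
  qed simp_all
  have T_add: "T (c + d) w = T c w + T d w" for c d w
    by (simp add: T_def k_add distrib_right)
  note F_add = word_sum_add(1)[of T, OF T_add, folded F_def]
  note F_word = word_sum_add(2)[of T, OF T_add, folded F_def]
  have F0: "F 0 = 0" using F_add[of 0 0] by simp
  have F_mult: "F (\<alpha> * \<beta>) = F \<alpha> * F \<beta>" for \<alpha> \<beta>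
  proof (rule multiplicative_if_on_words[of F, OF F_add])
    fix c d :: complex and u v :: "3 list"
    assume uv: "u \<noteq> []" "distinct_adj u" "v \<noteq> []" "distinct_adj v"
    have "T c u * T d v = k c * (\<phi> (chr (hd u)) * P u * \<phi> (const_alg d * chr (hd v))) * P v"
      unfolding T_def k_def by (simp only: mult.assoc \<phi>(3))
    also have "\<dots> = k c * k ((const_alg d * chr (hd v)) (last u)) * (\<phi> (chr (hd u)) * (P u * P v))"
      unfolding Q_right[OF uv(1,2)] by (simp only: mult.assoc)
    also have "\<dots> = (if last u = hd v then T (c * d) (u @ tl v) else 0)"
      using uv P_glue[of u v] by (auto simp: T_def k0 k1 k_mult chr_def const_alg_def mult.assoc)
    finally show "F (word_u c u * word_u d v) = F (word_u c u) * F (word_u d v)"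
      using uv by (auto simp: word_u_times F_word F0 distinct_adj_glue)
  qed
  have F_sum: "F (sum f S) = (\<Sum>x\<in>S. F (f x))" for f :: "'c \<Rightarrow> uform" and S
    by (induction S rule: infinite_finite_induct) (auto simp: F0 F_add)
  have phi0: "\<phi> 0 = 0" using \<phi>(2)[of 0 0] by simp
  have F_alg: "F (of_alg_u a) = \<phi> a" for a
  proof -
    have "F (of_alg_u a) = (\<Sum>x\<in>UNIV. \<phi> (const_alg (a x) * chr x))"
      by (simp add: of_alg_u_eq_sum F_sum F_word T_def P1 k_def \<phi>(3))
    also have "\<dots> = \<phi> (\<Sum>x\<in>UNIV. const_alg (a x) * chr x)"
      by (simp add: sum_3 \<phi>(2))
    also have "(\<Sum>x\<in>UNIV. const_alg (a x) * chr x) = a"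
    proof
      fix y show "(\<Sum>x\<in>UNIV. const_alg (a x) * chr x) y = a y"
        using exhaust_3[of y] by (auto simp: sum_3 const_alg_def chr_def)
    qed
    finally show ?thesis .
  qed
  have psi0: "\<psi> 0 = 0" using \<psi>(1)[of 0 0] by (simp add: udeg_zero)
  have psi_sum: "\<psi> (sum f S) = (\<Sum>x\<in>S. \<psi> (f x))" if "\<And>x. x \<in> S \<Longrightarrow> f x \<in> udeg 1"
    for f :: "3 list \<Rightarrow> uform" and S
    using that
    by (induction S rule: infinite_finite_induct) (auto simp: psi0 \<psi>(1) udeg_sum)
  have F_psi: "F m = \<psi> m" if m: "m \<in> udeg 1" for m
  proof -
    have "F (word_u c [x, y]) = \<psi> (word_u c [x, y])" if "x \<noteq> y" for c x y
    proof -
      have "\<phi> (chr x) * \<psi> (word_u 1 [x, y]) = \<psi> (word_u 1 [x, y])"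
        using \<psi>(2)[OF word_u_deg, of "chr x" 1 x y] that
        by (simp add: of_alg_u_times_word chr_def)
      thus ?thesis using that by (simp add: F_word T_def P2 P1 psi_word[of x y c])
    qed
    moreover have "hd w \<noteq> last w" if "coeff_u m w \<noteq> 0" for w
      using that m coeff_u_path[of m w] by (auto simp: udeg_def length_Suc_conv)
    ultimately have "(\<Sum>w | coeff_u m w \<noteq> 0. F (word_u (coeff_u m w) [hd w, last w])) =
        (\<Sum>w | coeff_u m w \<noteq> 0. \<psi> (word_u (coeff_u m w) [hd w, last w]))"
      by (intro sum.cong refl) auto
    thus ?thesis
      using udeg_1_eq_sum[OF m] F_sum psi_sum[OF word_u_deg] by metis
  qed
  show ?thesis
  proof (rule ex1I[of _ F])
    fix G
    assume "(\<forall>\<alpha> \<beta>. G (\<alpha> + \<beta>) = G \<alpha> + G \<beta>) \<and> (\<forall>\<alpha> \<beta>. G (\<alpha> * \<beta>) = G \<alpha> * G \<beta>) \<and>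
      (\<forall>a. G (of_alg_u a) = \<phi> a) \<and> (\<forall>m\<in>udeg 1. G m = \<psi> m)"
    hence G: "G (\<alpha> + \<beta>) = G \<alpha> + G \<beta>" "G (\<alpha> * \<beta>) = G \<alpha> * G \<beta>" "G (of_alg_u a) = \<phi> a"
      "m \<in> udeg 1 \<Longrightarrow> G m = \<psi> m" for \<alpha> \<beta> a m by auto
    have word: "G (word_u c w) = F (word_u c w)" if "w \<noteq> []" "distinct_adj w" for c w
      using that
    proof (induction w arbitrary: c rule: induct_list012)
      case (2 x)
      have "word_u c [x] = of_alg_u (const_alg c * chr x)"
        by (rule coeff_u_eqI)
          (auto simp: word_u.rep_eq of_alg_u.rep_eq const_alg_def chr_def length_Suc_conv)
      thus ?case using G(3) F_alg by simp
    next
      case (3 x y zs)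
      have "word_u c (x # y # zs) = word_u c [x, y] * word_u 1 (y # zs)"
        using 3 by (subst word_u_times) auto
      moreover have "G (word_u 1 (y # zs)) = F (word_u 1 (y # zs))" using 3 by simp
      ultimately show ?case using G(2,4) F_mult F_psi word_u_deg by metis
    qed simp_all
    have G0: "G 0 = 0" using G(1)[of 0 0] by simp
    show "G = F"
    proof
      fix \<omega> show "G \<omega> = F \<omega>"
        by (induction \<omega> rule: uform_induct) (auto simp: G0 F0 G(1) F_add word)
    qed
  qed (simp add: F_add F_mult F_alg F_psi)
qed

lemma rep_alg_add: "rep_alg (f + g) = rep_alg f + rep_alg g"
  by (simp add: rep_alg_def block_op_add mat22_add)

lemma pi_u_add: "pi_u (\<alpha> + \<beta>) = pi_u \<alpha> + pi_u \<beta>"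
  and pi_u_word: "w \<noteq> [] \<Longrightarrow> distinct_adj w \<Longrightarrow> pi_u (word_u c w) =
    rep_alg (const_alg c * chr (hd w)) * prod_list (map (\<lambda>y. comm_dirac (chr y)) (tl w))"
proof -
  let ?T = "\<lambda>c w. rep_alg (const_alg c * chr (hd w)) * prod_list (map (\<lambda>y. comm_dirac (chr y)) (tl w))"
  have T: "?T (c + d) w = ?T c w + ?T d w" for c d w
  proof -
    have "const_alg (c + d) = const_alg c + const_alg d" by (simp add: const_alg_def plus_fun_def)
    thus ?thesis by (simp add: distrib_right rep_alg_add)
  qed
  note * = word_sum_add(1,2)[of ?T, OF T, folded pi_u_def]
  show "pi_u (\<alpha> + \<beta>) = pi_u \<alpha> + pi_u \<beta>" by (rule *)
  show "w \<noteq> [] \<Longrightarrow> distinct_adj w \<Longrightarrow> pi_u (word_u c w) = ?T c w" by (rule *)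
qed

lemma pi_u_zero: "pi_u 0 = 0"
  using pi_u_add[of 0 0] by simp

lemma pi_u_sum: "pi_u (sum f S) = (\<Sum>x\<in>S. pi_u (f x))"
  by (induction S rule: infinite_finite_induct) (auto simp: pi_u_zero pi_u_add)

lemma unit_m_mult:
  "a \<noteq> b \<Longrightarrow> x' = y \<Longrightarrow> y \<in> {a, b} \<Longrightarrow> unit_m a b c x y ** unit_m a b d x' z = unit_m a b (c * d) x z"
  "x' \<noteq> y \<Longrightarrow> unit_m a b c x y ** unit_m a b d x' z = 0"
proof -
  show "unit_m a b c x y ** unit_m a b d x' z = unit_m a b (c * d) x z"
    if "a \<noteq> b" "x' = y" "y \<in> {a, b}"
  proof -
    have "y = a \<and> y \<noteq> b \<or> y = b \<and> y \<noteq> a" using that by auto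
    thus ?thesis using that(2)
      by (elim disjE conjE) (simp_all add: unit_m_def mat22_mult)
  qed
  show "unit_m a b c x y ** unit_m a b d x' z = 0" if "x' \<noteq> y"
  proof -
    have "\<not> (y = a \<and> x' = a)" "\<not> (y = b \<and> x' = b)" using that by auto
    thus ?thesis
      by (cases "y = a"; cases "y = b"; cases "x' = a"; cases "x' = b")
        (simp_all add: unit_m_def mat22_mult mat22_0)
  qed
qed

lemma path_m_mult:
  assumes "a \<noteq> b" "u \<noteq> []" "distinct_adj u" "v \<noteq> []" "distinct_adj v"
  shows "path_m a b c u ** path_m a b d v = (if last u = hd v then path_m a b (c * d) (u @ tl v) else 0)"
proof (cases "last u = hd v")
  case True
  have v: "v = hd v # tl v" using assms by simp
  have set: "set (u @ tl v) = set u \<union> set v"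
  proof -
    have "last u \<in> set u" using assms by simp
    hence "insert (hd v) (set u) = set u" using True by auto
    thus ?thesis by (subst (2) v) auto
  qed
  have hdl: "hd (u @ tl v) = hd u" using assms by simp
  have last: "last (u @ tl v) = last v"
    using assms True by (cases v; cases "tl v") auto
  have glue: "u @ tl v \<noteq> []" "distinct_adj (u @ tl v)"
    using assms distinct_adj_glue True by auto
  have m: "hd v \<in> {a, b}" if "set v \<subseteq> {a, b}" using that assms(4) hd_in_set by blast
  show ?thesis
    unfolding path_m_eq[OF assms(1-3)] path_m_eq[OF assms(1,4,5)] path_m_eq[OF assms(1) glue]
      set hdl last
    using True unit_m_mult(1)[OF assms(1) _ m, of "hd v" c "hd u" d "last v"] by simp
next
  case False
  thus ?thesis
    unfolding path_m_eq[OF assms(1-3)] path_m_eq[OF assms(1,4,5)]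
    by (simp add: unit_m_mult(2)[OF not_sym])
qed

lemma pi_u_mult: "pi_u (\<alpha> * \<beta>) = pi_u \<alpha> * pi_u \<beta>"
proof (rule multiplicative_if_on_words[of pi_u, OF pi_u_add])
  fix c d :: complex and u v :: "3 list"
  assume uv: "u \<noteq> []" "distinct_adj u" "v \<noteq> []" "distinct_adj v"
  thus "pi_u (word_u c u * word_u d v) = pi_u (word_u c u) * pi_u (word_u d v)"
    using distinct_adj_glue[OF uv]
    by (simp add: word_u_times pi_u_word[unfolded path_block] block_op_mult path_m_mult pi_u_zero
        block_op_zero)
qed

lemma pi_u_of_alg: "pi_u (of_alg_u a) = rep_alg a"
  by (simp add: of_alg_u_eq_sum pi_u_add pi_u_word sum_3 rep_alg_add[symmetric] rep_alg_def
      const_alg_def chr_def block_op_add mat22_add)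

lemma diff_u_of_alg: "diff_u (of_alg_u a) = (\<Sum>x\<in>UNIV. \<Sum>y\<in>UNIV. word_u (a y - a x) [x, y])"
proof (rule coeff_u_eqI)
  fix w :: "3 list" assume w: "w \<noteq> []" "distinct_adj w"
  have "coeff_u (\<Sum>x\<in>UNIV. \<Sum>y\<in>UNIV. word_u (a y - a x) [x, y]) w =
      (\<Sum>x\<in>UNIV. \<Sum>y\<in>UNIV. if w = [x, y] then a y - a x else 0)"
    unfolding coeff_u_sum using w by (intro sum.cong refl) (auto simp: word_u.rep_eq)
  also have "\<dots> = coeff_u (diff_u (of_alg_u a)) w"
  proof (cases "length w = 2")
    case True
    then obtain p q where pq: "w = [p, q]" by (auto simp: length_Suc_conv numeral_2_eq_2)
    have "(\<Sum>x\<in>UNIV. \<Sum>y\<in>UNIV. if w = [x, y] then a y - a x else 0) =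
        (\<Sum>x\<in>UNIV. if x = p then \<Sum>y\<in>UNIV. if y = q then a q - a p else 0 else 0)"
      unfolding pq by (intro sum.cong refl) (auto intro!: sum.cong sum.neutral)
    also have "\<dots> = a q - a p" by simp
    finally show ?thesis
      by (simp add: pq diff_u.rep_eq path_diff_Cons of_alg_u.rep_eq)
  next
    case False
    have "coeff_u (diff_u (of_alg_u a)) w = 0"
      unfolding diff_u.rep_eq path_diff_def
      by (rule sum.neutral) (use False in \<open>auto simp: of_alg_u.rep_eq\<close>)
    thus ?thesis using False by (auto intro!: sum.neutral)
  qed
  finally show "coeff_u (diff_u (of_alg_u a)) w = coeff_u (\<Sum>x\<in>UNIV. \<Sum>y\<in>UNIV. word_u (a y - a x) [x, y]) w" ..
qed

lemma word_u_repeat: "word_u c [x, x] = 0"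
  by transfer auto

lemma pi_u_diff_of_alg: "pi_u (diff_u (of_alg_u a)) = comm_dirac a"
proof -
  have "pi_u (word_u c [x, y]) = (if x = y then 0 else
      rep_alg (const_alg c * chr x) * comm_dirac (chr y))" for c x y
    by (simp add: word_u_repeat pi_u_zero pi_u_word)
  thus ?thesis
    by (simp add: diff_u_of_alg pi_u_add sum_3 rep_alg_block comm_dirac_block diag_m_def comm_m_def
        block_op_mult block_op_add mat22_mult mat22_add chr_def const_alg_def pi_u_zero)
qed

lemma pi_u_elementary:
  "pi_u (of_alg_u a * prod_list (map (\<lambda>b. diff_u (of_alg_u b)) bs)) =
    rep_alg a * prod_list (map comm_dirac bs)"
proof -
  have "pi_u 1 = 1" using pi_u_of_alg[of 1]
    by (simp add: of_alg_u_hom rep_alg_def mat22_1 block_op_one)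
  hence "pi_u (prod_list (map (\<lambda>b. diff_u (of_alg_u b)) bs)) = prod_list (map comm_dirac bs)"
    by (induction bs) (auto simp: pi_u_mult pi_u_diff_of_alg)
  thus ?thesis by (simp add: pi_u_mult pi_u_of_alg)
qed

section \<open>The differential star-calculus of Connes forms\<close>

lemma neg_one_power_times_coeff_u: "coeff_u ((-1) ^ n * \<omega>) w = (-1) ^ n * coeff_u \<omega> w"
  by (cases "even n") (simp_all add: uminus_uform.rep_eq)

lemma path_mult_deg:
  assumes f: "\<And>w. f w \<noteq> 0 \<Longrightarrow> length w = Suc p" and g: "\<And>w. g w \<noteq> 0 \<Longrightarrow> length w = Suc q"
  shows "path_mult f g w =
    (if length w = Suc (p + q) then f (take (Suc p) w) * g (drop p w) else 0)"
proof -
  have "f (take (Suc k) w) * g (drop k w) =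
      (if k = p then if length w = Suc (p + q) then f (take (Suc p) w) * g (drop p w) else 0 else 0)"
    if "k < length w" for k
  proof (cases "f (take (Suc k) w) * g (drop k w) = 0")
    case False
    hence "f (take (Suc k) w) \<noteq> 0" "g (drop k w) \<noteq> 0" by auto
    hence "length (take (Suc k) w) = Suc p" "length (drop k w) = Suc q" using f g by blast+
    hence "k = p" "length w = Suc (p + q)" using that by auto
    thus ?thesis by simp
  qed auto
  hence "path_mult f g w =
      (\<Sum>k<length w. if k = p then if length w = Suc (p + q) then f (take (Suc p) w) * g (drop p w) else 0 else 0)"
    unfolding path_mult_def by (intro sum.cong) auto
  thus ?thesis by auto
qed

lemma diff_u_diff_u: "diff_u (diff_u \<omega>) = 0"
  by transfer (simp add: fun_eq_iff path_diff_twice)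

lemma diff_u_mult:
  assumes "\<alpha> \<in> udeg p"
  shows "diff_u (\<alpha> * \<beta>) = diff_u \<alpha> * \<beta> + (-1) ^ p * (\<alpha> * diff_u \<beta>)"
proof (rule coeff_u_eqI)
  fix w :: "3 list"
  have nil: "coeff_u \<alpha> [] = 0" "coeff_u \<beta> [] = 0" using coeff_u_path by blast+
  have "(\<lambda>u. (-1) ^ length u * coeff_u \<alpha> u) = (\<lambda>u. (-1) ^ Suc p * coeff_u \<alpha> u)"
  proof
    fix u show "(-1) ^ length u * coeff_u \<alpha> u = (-1) ^ Suc p * coeff_u \<alpha> u"
      using assms by (cases "coeff_u \<alpha> u = 0") (simp_all add: udeg_def)
  qed
  hence "path_mult (\<lambda>u. (-1) ^ length u * coeff_u \<alpha> u) (path_diff (coeff_u \<beta>)) w =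
      (-1) ^ Suc p * path_mult (coeff_u \<alpha>) (path_diff (coeff_u \<beta>)) w"
    by (simp only: path_mult_scale_left)
  moreover have "coeff_u ((-1) ^ p * (\<alpha> * diff_u \<beta>)) w =
      (-1) ^ p * path_mult (coeff_u \<alpha>) (path_diff (coeff_u \<beta>)) w"
    by (subst neg_one_power_times_coeff_u) (simp only: times_uform.rep_eq diff_u.rep_eq)
  ultimately show "coeff_u (diff_u (\<alpha> * \<beta>)) w =
      coeff_u (diff_u \<alpha> * \<beta> + (-1) ^ p * (\<alpha> * diff_u \<beta>)) w"
    unfolding plus_uform.rep_eq
    by (simp add: diff_u.rep_eq times_uform.rep_eq
        path_diff_mult_aux[of "coeff_u \<beta>", OF nil(2)] nil)
qed

lemma star_u_mult:
  assumes "\<alpha> \<in> udeg p" "\<beta> \<in> udeg q"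
  shows "star_u (\<alpha> * \<beta>) = (-1) ^ (p * q) * (star_u \<beta> * star_u \<alpha>)"
proof (rule coeff_u_eqI)
  fix w :: "3 list"
  have f: "coeff_u \<alpha> v \<noteq> 0 \<Longrightarrow> length v = Suc p" and g: "coeff_u \<beta> v \<noteq> 0 \<Longrightarrow> length v = Suc q" for v
    using assms by (auto simp: udeg_def)
  have f': "path_star (coeff_u \<alpha>) v \<noteq> 0 \<Longrightarrow> length v = Suc p"
    and g': "path_star (coeff_u \<beta>) v \<noteq> 0 \<Longrightarrow> length v = Suc q" for v
    using f[of "rev v"] g[of "rev v"] by (auto simp: path_star_def)
  have L: "coeff_u (star_u (\<alpha> * \<beta>)) w = (-1) ^ ((length w - 1) * length w div 2) *
      cnj (if length w = Suc (p + q) then coeff_u \<alpha> (take (Suc p) (rev w)) * coeff_u \<beta> (drop p (rev w)) else 0)"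
    by (simp add: star_u.rep_eq path_star_def times_uform.rep_eq path_mult_deg[of "coeff_u \<alpha>" p "coeff_u \<beta>" q, OF f g])
  have R: "coeff_u ((-1) ^ (p * q) * (star_u \<beta> * star_u \<alpha>)) w = (-1) ^ (p * q) *
      (if length w = Suc (q + p) then path_star (coeff_u \<beta>) (take (Suc q) w) * path_star (coeff_u \<alpha>) (drop q w) else 0)"
    by (subst neg_one_power_times_coeff_u) (simp add: times_uform.rep_eq star_u.rep_eq
        path_mult_deg[of "path_star (coeff_u \<beta>)" q "path_star (coeff_u \<alpha>)" p, OF g' f'])
  show "coeff_u (star_u (\<alpha> * \<beta>)) w = coeff_u ((-1) ^ (p * q) * (star_u \<beta> * star_u \<alpha>)) w"
  proof (cases "length w = Suc (p + q)")
    case True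
    have "even (p * Suc p)" "even (q * Suc q)" by auto
    then obtain r s where "p * Suc p = 2 * r" "q * Suc q = 2 * s" by (auto simp only: dvd_def)
    moreover have "(p + q) * Suc (p + q) = p * Suc p + q * Suc q + 2 * (p * q)"
      by (simp add: algebra_simps)
    ultimately have "(p + q) * Suc (p + q) div 2 = p * q + q * Suc q div 2 + p * Suc p div 2"
      by simp
    hence sgn: "(-1 :: complex) ^ ((p + q) * Suc (p + q) div 2) =
        (-1) ^ (p * q) * (-1) ^ (q * Suc q div 2) * (-1) ^ (p * Suc p div 2)"
      by (simp only: power_add)
    have rev_w: "take (Suc p) (rev w) = rev (drop q w)" "drop p (rev w) = rev (take (Suc q) w)"
      unfolding take_rev drop_rev True by (simp_all only: diff_Suc_Suc diff_add_inverse Suc_diff_le le_add1)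
    have "coeff_u (star_u (\<alpha> * \<beta>)) w = (-1) ^ ((p + q) * Suc (p + q) div 2) *
        (cnj (coeff_u \<alpha> (rev (drop q w))) * cnj (coeff_u \<beta> (rev (take (Suc q) w))))"
      unfolding L rev_w True by (simp del: mult_Suc_right)
    also have "\<dots> = (-1) ^ (p * q) *
        ((-1) ^ (q * Suc q div 2) * cnj (coeff_u \<beta> (rev (take (Suc q) w))) *
          ((-1) ^ (p * Suc p div 2) * cnj (coeff_u \<alpha> (rev (drop q w)))))"
      unfolding sgn by (simp only: mult_ac)
    also have "\<dots> = coeff_u ((-1) ^ (p * q) * (star_u \<beta> * star_u \<alpha>)) w"
    proof -
      have "length w = Suc (q + p)" "length (take (Suc q) w) = Suc q" "length (drop q w) = Suc p"
        by (simp_all add: True)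
      thus ?thesis unfolding R path_star_def by (simp del: mult_Suc_right)
    qed
    finally show ?thesis .
  qed (simp add: L R)
qed

lemma diff_u_star_u: "diff_u (star_u \<omega>) = star_u (diff_u \<omega>)"
proof (rule coeff_u_eqI)
  fix w :: "3 list" assume "w \<noteq> []"
  then obtain m where m: "length w = Suc m" by (cases w) auto
  let ?f = "coeff_u \<omega>"
  have "even (m * (m - 1))" "even (m * Suc m)" by auto
  then obtain r s where rs: "m * (m - 1) = 2 * r" "m * Suc m = 2 * s" by (auto simp only: dvd_def)
  moreover have "m * Suc m = m * (m - 1) + 2 * m" by (cases m) (simp_all add: algebra_simps)
  ultimately have e: "m * Suc m div 2 = m * (m - 1) div 2 + m" by simp
  have t: "(-1) ^ (m * Suc m div 2) * cnj ((-1) ^ (m - k) * ?f (take (m - k) (rev w) @ drop (Suc (m - k)) (rev w))) =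
      (-1) ^ k * path_star ?f (take k w @ drop (Suc k) w)" if "k < Suc m" for k
  proof -
    have "m - (m - k) = k" "Suc m - (m - k) = Suc k" using that by simp_all
    hence a: "take (m - k) (rev w) @ drop (Suc (m - k)) (rev w) = rev (take k w @ drop (Suc k) w)"
      by (simp only: take_rev drop_rev m diff_Suc_Suc rev_append)
    have len: "length (take k w @ drop (Suc k) w) = m" using that m by auto
    have "m + (m - k) = 2 * (m - k) + k" using that by simp
    hence "(-1 :: complex) ^ m * (-1) ^ (m - k) = (-1) ^ (2 * (m - k) + k)"
      by (simp only: power_add[symmetric])
    hence sgn: "(-1 :: complex) ^ m * (-1) ^ (m - k) = (-1) ^ k"
      by (simp only: power_add power_minus1_even mult_1)
    have "(-1) ^ (m * Suc m div 2) * cnj ((-1) ^ (m - k) * ?f v) =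
        ((-1) ^ m * (-1) ^ (m - k)) * ((-1) ^ (m * (m - 1) div 2) * cnj (?f v))" for v
      unfolding e power_add complex_cnj_mult complex_cnj_power complex_cnj_minus complex_cnj_one
      by (simp only: mult_ac)
    thus ?thesis
      unfolding a path_star_def len sgn by (simp only: mult.commute[of "m - 1"])
  qed
  have "coeff_u (star_u (diff_u \<omega>)) w = (\<Sum>k<Suc m. (-1) ^ (m * Suc m div 2) *
      cnj ((-1) ^ k * ?f (take k (rev w) @ drop (Suc k) (rev w))))"
    by (simp add: star_u.rep_eq path_star_def diff_u.rep_eq path_diff_def m sum_distrib_left
        del: sum.lessThan_Suc)
  also have "\<dots> = (\<Sum>k<Suc m. (-1) ^ (m * Suc m div 2) *
      cnj ((-1) ^ (m - k) * ?f (take (m - k) (rev w) @ drop (Suc (m - k)) (rev w))))"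
    by (subst sum.nat_diff_reindex[symmetric]) (simp del: sum.lessThan_Suc)
  also have "\<dots> = (\<Sum>k<Suc m. (-1) ^ k * path_star ?f (take k w @ drop (Suc k) w))"
    by (rule sum.cong) (simp_all only: t lessThan_iff)
  also have "\<dots> = coeff_u (diff_u (star_u \<omega>)) w"
    by (simp add: star_u.rep_eq diff_u.rep_eq path_diff_def m del: sum.lessThan_Suc)
  finally show "coeff_u (diff_u (star_u \<omega>)) w = coeff_u (star_u (diff_u \<omega>)) w" ..
qed

lemma connes_rel_refl: "connes_rel \<omega> \<omega>"
  by (simp add: connes_rel_def connes_ideal_eq_J0 J0_zero)

lemma abs_form_simps:
  "abs_form \<alpha> + abs_form \<beta> = abs_form (\<alpha> + \<beta>)" "abs_form \<alpha> * abs_form \<beta> = abs_form (\<alpha> * \<beta>)"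
  "diff (abs_form \<alpha>) = abs_form (diff_u \<alpha>)" "star (abs_form \<alpha>) = abs_form (star_u \<alpha>)"
  by (simp_all add: plus_form.abs_eq times_form.abs_eq diff.abs_eq star.abs_eq)

lemma neg_one_power_abs_form: "(-1) ^ n * abs_form \<alpha> = abs_form ((-1) ^ n * \<alpha>)"
  by (cases "even n") (simp_all add: uminus_form.abs_eq)

lemma vector_space_form: "vector_space scale"
proof
  fix a b :: complex and x y :: form
  show "scale a (x + y) = scale a x + scale a y"
    by transfer (rule back_subst[of "connes_rel _", OF connes_rel_refl],
        transfer, simp add: fun_eq_iff distrib_left)
  show "scale (a + b) x = scale a x + scale b x"
    by transfer (rule back_subst[of "connes_rel _", OF connes_rel_refl],
        transfer, simp add: fun_eq_iff distrib_right)
  show "scale a (scale b x) = scale (a * b) x"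
    by transfer (rule back_subst[of "connes_rel _", OF connes_rel_refl],
        transfer, simp add: fun_eq_iff mult.assoc)
  show "scale 1 x = x"
    by transfer (rule back_subst[of "connes_rel _", OF connes_rel_refl],
        transfer, simp add: fun_eq_iff)
qed

lemma diff_diff: "diff (diff \<xi>) = 0"
  by transfer (simp add: diff_u_diff_u connes_rel_refl)

lemma diff_mult:
  assumes "\<xi> \<in> Omega p"
  shows "diff (\<xi> * \<eta>) = diff \<xi> * \<eta> + (-1) ^ p * (\<xi> * diff \<eta>)"
proof -
  obtain \<alpha> where "\<xi> = abs_form \<alpha>" "\<alpha> \<in> udeg p"
    using assms unfolding Omega_def by blast
  moreover have "\<exists>\<beta>. \<eta> = abs_form \<beta>" by (induction \<eta> rule: form.abs_induct) blast
  then obtain \<beta> where "\<eta> = abs_form \<beta>" ..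
  ultimately show ?thesis by (simp add: abs_form_simps neg_one_power_abs_form diff_u_mult)
qed

lemma star_mult:
  assumes "\<xi> \<in> Omega p" "\<eta> \<in> Omega q"
  shows "star (\<xi> * \<eta>) = (-1) ^ (p * q) * (star \<eta> * star \<xi>)"
proof -
  obtain \<alpha> \<beta> where "\<xi> = abs_form \<alpha>" "\<alpha> \<in> udeg p" "\<eta> = abs_form \<beta>" "\<beta> \<in> udeg q"
    using assms unfolding Omega_def by blast
  thus ?thesis by (simp add: abs_form_simps neg_one_power_abs_form star_u_mult)
qed

lemma diff_star: "diff (star \<xi>) = star (diff \<xi>)"
  by transfer (simp add: diff_u_star_u connes_rel_refl)

lemma star_star: "star (star \<xi>) = \<xi>"
proof transfer
  fix \<omega>
  have "star_u (star_u \<omega>) = \<omega>"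
    by transfer (simp add: fun_eq_iff path_star_def flip: mult.assoc power_mult_distrib)
  thus "connes_rel (star_u (star_u \<omega>)) \<omega>" by (simp add: connes_rel_refl)
qed

lemma star_add: "star (\<xi> + \<eta>) = star \<xi> + star \<eta>"
proof transfer
  fix \<alpha> \<beta>
  have "star_u (\<alpha> + \<beta>) = star_u \<alpha> + star_u \<beta>"
    by transfer (simp add: fun_eq_iff path_star_def distrib_left)
  thus "connes_rel (star_u (\<alpha> + \<beta>)) (star_u \<alpha> + star_u \<beta>)" by (simp add: connes_rel_refl)
qed

lemma star_scale: "star (scale c \<xi>) = scale (cnj c) (star \<xi>)"
proof transfer
  fix c \<alpha>
  have "star_u (scale_u c \<alpha>) = scale_u (cnj c) (star_u \<alpha>)"
    by transfer (simp add: fun_eq_iff path_star_def)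
  thus "connes_rel (star_u (scale_u c \<alpha>)) (scale_u (cnj c) (star_u \<alpha>))" by (simp add: connes_rel_refl)
qed

lemma star_of_alg: "star (of_alg a) = of_alg (star_alg a)"
proof transfer
  fix a
  have "star_u (of_alg_u a) = of_alg_u (star_alg a)"
    by transfer (auto simp: fun_eq_iff path_star_def star_alg_def length_Suc_conv)
  thus "connes_rel (star_u (of_alg_u a)) (of_alg_u (star_alg a))" by (simp add: connes_rel_refl)
qed

lemma of_alg_hom:
  "of_alg 1 = 1" "of_alg (a + b) = of_alg a + of_alg b" "of_alg (a * b) = of_alg a * of_alg b"
  by (transfer, simp add: of_alg_u_hom connes_rel_refl)+

lemma inj_of_alg: "inj of_alg"
proof (rule injI)
  fix a b assume "of_alg a = of_alg b"
  hence "connes_rel (of_alg_u a) (of_alg_u b)" by transfer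
  hence "coeff_u (of_alg_u a - of_alg_u b) [x] = 0" for x
    unfolding connes_rel_def connes_ideal_eq_J0 J0_iff by simp
  thus "a = b" by (simp add: fun_eq_iff minus_uform.rep_eq of_alg_u.rep_eq)
qed

lemma Omega_0: "Omega 0 = range of_alg"
proof -
  have "\<omega> = of_alg_u (\<lambda>x. coeff_u \<omega> [x])" if "\<omega> \<in> udeg 0" for \<omega>
    by (rule coeff_u_eqI) (use that in \<open>auto simp: udeg_def of_alg_u.rep_eq length_Suc_conv\<close>)
  hence "udeg 0 = range of_alg_u"
    by (auto simp: udeg_def of_alg_u.rep_eq split: if_splits)
  thus ?thesis unfolding Omega_def of_alg_def by (simp add: image_image)
qed

text \<open>In degree 1, dividing by the ideal identifies exactly the forms with equal image under
  \<open>\<pi>\<^sub>u\<close>.\<close>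

lemma abs_form_eq_iff_pi_u:
  assumes "\<alpha> \<in> udeg 1" "\<beta> \<in> udeg 1"
  shows "abs_form \<alpha> = abs_form \<beta> \<longleftrightarrow> pi_u \<alpha> = pi_u \<beta>"
proof -
  have "\<alpha> - \<beta> \<in> udeg 1" using assms by (simp add: udeg_iff minus_uform.rep_eq)
  hence "abs_form \<alpha> = abs_form \<beta> \<longleftrightarrow> pi_u (\<alpha> - \<beta>) = 0"
    by (simp add: form.abs_eq_iff connes_rel_def connes_ideal_eq_J0 J0_iff pi_u_eq_0_iff)
  also have "pi_u (\<alpha> - \<beta>) = pi_u \<alpha> - pi_u \<beta>"
    using pi_u_add[of "\<alpha> - \<beta>" \<beta>] by (simp add: algebra_simps)
  finally show ?thesis by simp
qed

section \<open>Complex structures\<close>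

definition almost_complex_structure :: "(form \<Rightarrow> form) \<Rightarrow> bool" where
  "almost_complex_structure J \<longleftrightarrow>
    Vector_Spaces.linear scale scale J \<and>
    (\<forall>n. J ` Omega n \<subseteq> Omega n) \<and>
    (\<forall>\<xi> \<eta>. J (\<xi> * \<eta>) = J \<xi> * \<eta> + \<xi> * J \<eta>) \<and>
    (\<forall>a. J (of_alg a) = 0) \<and>
    (\<forall>\<xi>\<in>Omega 1. J (J \<xi>) = - \<xi>) \<and>
    (\<forall>\<xi>\<in>Omega 1. J (star \<xi>) = star (J \<xi>))"

definition Omega_pq :: "(form \<Rightarrow> form) \<Rightarrow> nat \<Rightarrow> nat \<Rightarrow> form set" where
  "Omega_pq J p q = {\<xi> \<in> Omega (p + q). J \<xi> = scale ((of_nat p - of_nat q) * \<i>) \<xi>}"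

definition complex_structure :: "(form \<Rightarrow> form) \<Rightarrow> bool" where
  "complex_structure J \<longleftrightarrow> almost_complex_structure J \<and>
    (\<forall>\<xi>\<in>Omega_pq J 1 0. \<exists>\<alpha>\<in>Omega_pq J 2 0. \<exists>\<beta>\<in>Omega_pq J 1 1. diff \<xi> = \<alpha> + \<beta>)"

definition e1 :: form where "e1 = diff (of_alg (chr 1))"
definition e2 :: form where "e2 = diff (of_alg (chr 2))"

text \<open>\<open>M $ k $ i\<close> is the entry \<open>J\<^sub>k\<^sub>i\<close>. It is unique because \<open>e\<^sub>1, e\<^sub>2\<close> is a free right
  \<open>A\<close>-module basis of \<open>\<Omega>\<^sup>1\<close>.\<close>

definition matrix_of :: "(form \<Rightarrow> form) \<Rightarrow> alg^2^2" where
  "matrix_of J = (THE M.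
     J e1 = e1 * of_alg (M $ 1 $ 1) + e2 * of_alg (M $ 2 $ 1) \<and>
     J e2 = e1 * of_alg (M $ 1 $ 2) + e2 * of_alg (M $ 2 $ 2))"

definition scale_mat :: "complex \<Rightarrow> alg^2^2 \<Rightarrow> alg^2^2" where
  "scale_mat c M = (\<chi> k i. const_alg c * M $ k $ i)"

end

theory Submission
  imports Defs
begin

text \<open>
  A Connes form is a finitely supported function on the walks \<open>y\<^sub>0 \<dots> y\<^sub>p\<close> in the complete graph on
  \<open>Y\<close> that visit at most two points. In degree 1 the walks \<open>xy\<close> span the simple subbimodules
  \<open>\<chi>\<^sub>x \<Omega>\<^sup>1 \<chi>\<^sub>y\<close>, so an almost complex structure multiplies each of them by a number \<open>c(x, y)\<close>, and
  the Leibniz rule forces the factor on a longer walk to be the sum of \<open>c\<close> over its steps.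
  Conversely every \<open>c\<close> gives a derivation in this way. The condition \<open>J\<^sup>2 = -1\<close> means
  \<open>c(x, y) = \<plusminus>i\<close>, and compatibility with the involution means \<open>c(y, x) = cnj (c(x, y))\<close>, so
  \<open>c\<close> is given by three independent signs. Integrability is automatic: a walk with two steps and
  at most two points is \<open>xyx\<close>, so \<open>J = 0\<close> on \<open>\<Omega>\<^sup>2 = \<Omega>\<^bsup>1,1\<^esup>\<close>.
\<close>

section \<open>Coefficients of Connes forms\<close>

text \<open>By \<open>J0_iff\<close> the ideal consists of the forms that vanish on all walks
  through at most two points. Restricting to these walks therefore gives well-defined coordinates on
  the quotient, and \<open>form_eqI\<close> shows that they are complete.\<close>

lift_definition coeff :: "form \<Rightarrow> 3 list \<Rightarrow> complex" is
  "\<lambda>\<omega> w. if card (set w) \<le> 2 then coeff_u \<omega> w else 0"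
  by (auto simp: fun_eq_iff connes_rel_def connes_ideal_eq_J0 J0_iff minus_uform.rep_eq)

lemma coeff_abs_form: "coeff (abs_form \<omega>) w = (if card (set w) \<le> 2 then coeff_u \<omega> w else 0)"
  by (simp add: coeff.abs_eq)

lemma form_eqI: "(\<And>w. coeff \<xi> w = coeff \<eta> w) \<Longrightarrow> \<xi> = \<eta>"
  by transfer (simp add: connes_rel_def connes_ideal_eq_J0 J0_iff minus_uform.rep_eq, metis)

lemma coeff_nonzero:
  assumes "coeff \<xi> w \<noteq> 0"
  shows "w \<noteq> []" "distinct_adj w" "card (set w) \<le> 2"
proof -
  obtain \<omega> where "\<xi> = abs_form \<omega>" by (induction \<xi> rule: form.abs_induct) blast
  thus "w \<noteq> []" "distinct_adj w" "card (set w) \<le> 2"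
    using assms coeff_u_path[of \<omega> w] by (auto simp: coeff_abs_form split: if_splits)
qed

lemma coeff_linear [simp]:
  "coeff 0 w = 0" "coeff (- \<xi>) w = - coeff \<xi> w"
  "coeff (\<xi> + \<eta>) w = coeff \<xi> w + coeff \<eta> w" "coeff (scale a \<xi>) w = a * coeff \<xi> w"
  by (transfer, simp add: zero_uform.rep_eq uminus_uform.rep_eq plus_uform.rep_eq scale_u.rep_eq)+

lemma coeff_of_alg: "coeff (of_alg a) w = (if length w = 1 then a (hd w) else 0)"
proof -
  have "card (set w) \<le> 2" if "length w = 1"
    using that card_length[of w] by simp
  thus ?thesis by transfer (auto simp: of_alg_u.rep_eq)
qed

text \<open>Subwalks of \<open>w\<close> visit no further points, so the cutoff does not affect the
  factors. On \<open>[1, 2, 3]\<close> the formula can fail: the left side is 0, but the edges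
  \<open>[1, 2]\<close> and \<open>[2, 3]\<close> may contribute on the right.\<close>

lemma coeff_times:
  assumes "card (set w) \<le> 2"
  shows "coeff (\<xi> * \<eta>) w = (\<Sum>k<length w. coeff \<xi> (take (Suc k) w) * coeff \<eta> (drop k w))"
proof -
  have "card (set (take k w)) \<le> 2" "card (set (drop k w)) \<le> 2" for k
    using card_set_le[OF set_take_subset assms] card_set_le[OF set_drop_subset assms] by auto
  thus ?thesis using assms by transfer (simp add: times_uform.rep_eq path_mult_def)
qed

lemma coeff_star:
  "coeff (star \<xi>) w = (-1) ^ ((length w - 1) * length w div 2) * cnj (coeff \<xi> (rev w))"
  by transfer (simp add: star_u.rep_eq path_star_def)

lemma coeff_diff:
  assumes "card (set w) \<le> 2"
  shows "coeff (diff \<xi>) w = (\<Sum>k<length w. (-1) ^ k * coeff \<xi> (take k w @ drop (Suc k) w))"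
proof -
  have "set (take k w @ drop (Suc k) w) \<subseteq> set w" for k
    by (auto dest: in_set_takeD in_set_dropD)
  hence "card (set (take k w @ drop (Suc k) w)) \<le> 2" for k
    using card_set_le assms by blast
  thus ?thesis using assms by transfer (simp add: diff_u.rep_eq path_diff_def)
qed

section \<open>Degrees, and one-forms as functions on edges\<close>

lemma Omega_iff: "\<xi> \<in> Omega n \<longleftrightarrow> (\<forall>w. coeff \<xi> w \<noteq> 0 \<longrightarrow> length w = Suc n)"
proof
  assume "\<xi> \<in> Omega n"
  thus "\<forall>w. coeff \<xi> w \<noteq> 0 \<longrightarrow> length w = Suc n"
    by (auto simp: Omega_def udeg_def coeff_abs_form split: if_splits)
next
  assume *: "\<forall>w. coeff \<xi> w \<noteq> 0 \<longrightarrow> length w = Suc n"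
  obtain \<omega> where \<omega>: "\<xi> = abs_form \<omega>" by (induction \<xi> rule: form.abs_induct) blast
  \<comment> \<open>The representative may have parts of other degrees that lie in the ideal; its
    degree \<open>n\<close> component represents the same class.\<close>
  have "coeff \<xi> w = coeff (abs_form (ucomp n \<omega>)) w" for w
    using * by (cases "coeff \<xi> w = 0") (auto simp: \<omega> coeff_abs_form ucomp.rep_eq)
  hence "\<xi> = abs_form (ucomp n \<omega>)" by (rule form_eqI)
  moreover have "ucomp n \<omega> \<in> udeg n" by (simp add: udeg_def ucomp.rep_eq)
  ultimately show "\<xi> \<in> Omega n" by (auto simp: Omega_def)
qed

lemma card_pair_le_2: "card {x, y} \<le> 2"
  by (simp add: card_insert_if)

lemma Omega_1_eqI:
  assumes "\<xi> \<in> Omega 1" "\<eta> \<in> Omega 1" "\<And>x y. x \<noteq> y \<Longrightarrow> coeff \<xi> [x, y] = coeff \<eta> [x, y]"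
  shows "\<xi> = \<eta>"
proof (rule form_eqI)
  fix w
  show "coeff \<xi> w = coeff \<eta> w"
  proof (cases "coeff \<xi> w = 0 \<and> coeff \<eta> w = 0")
    case False
    then obtain \<zeta> where \<zeta>: "\<zeta> \<in> Omega 1" "coeff \<zeta> w \<noteq> 0" using assms(1,2) by blast
    hence "length w = 2" "distinct_adj w" using coeff_nonzero by (auto simp: Omega_iff)
    then obtain x y where "w = [x, y]" "x \<noteq> y" by (auto simp: length_Suc_conv numeral_2_eq_2)
    thus ?thesis using assms(3) by simp
  qed simp
qed

lemma coeff_times_of_alg [simp]:
  "coeff (\<xi> * of_alg a) [x, y] = coeff \<xi> [x, y] * a y"
  "coeff (of_alg a * \<xi>) [x, y] = a x * coeff \<xi> [x, y]"
  by (simp_all add: coeff_times card_pair_le_2 coeff_of_alg)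

lemma coeff_diff_of_alg: "coeff (diff (of_alg a)) [x, y] = a y - a x"
  by (simp add: coeff_diff card_pair_le_2 coeff_of_alg)

lemma diff_Omega: "\<xi> \<in> Omega n \<Longrightarrow> diff \<xi> \<in> Omega (Suc n)"
  unfolding Omega_iff
proof (intro allI impI)
  fix w assume *: "\<forall>w. coeff \<xi> w \<noteq> 0 \<longrightarrow> length w = Suc n" and w: "coeff (diff \<xi>) w \<noteq> 0"
  have "\<exists>k<length w. coeff \<xi> (take k w @ drop (Suc k) w) \<noteq> 0"
  proof (rule ccontr)
    assume "\<not> ?thesis"
    hence "coeff (diff \<xi>) w = 0"
      unfolding coeff_diff[OF coeff_nonzero(3)[OF w]] by (intro sum.neutral) auto
    with w show False by blast
  qed
  then obtain k where "k < length w" "length (take k w @ drop (Suc k) w) = Suc n"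
    using * by blast
  thus "length w = Suc (Suc n)" by simp
qed

lemma Omega_add: "\<xi> \<in> Omega n \<Longrightarrow> \<eta> \<in> Omega n \<Longrightarrow> \<xi> + \<eta> \<in> Omega n"
  unfolding Omega_iff by (metis add_0 coeff_linear(3))

lemma Omega_times:
  assumes "\<xi> \<in> Omega p" "\<eta> \<in> Omega q"
  shows "\<xi> * \<eta> \<in> Omega (p + q)"
  unfolding Omega_iff
proof (intro allI impI)
  fix w assume w: "coeff (\<xi> * \<eta>) w \<noteq> 0"
  have "\<exists>k<length w. coeff \<xi> (take (Suc k) w) \<noteq> 0 \<and> coeff \<eta> (drop k w) \<noteq> 0"
  proof (rule ccontr)
    assume "\<not> ?thesis"
    hence "coeff (\<xi> * \<eta>) w = 0"
      unfolding coeff_times[OF coeff_nonzero(3)[OF w]] by (intro sum.neutral) auto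
    with w show False by blast
  qed
  then obtain k where "k < length w" "length (take (Suc k) w) = Suc p" "length (drop k w) = Suc q"
    using assms unfolding Omega_iff by blast
  thus "length w = Suc (p + q)" by simp
qed

lemma of_alg_Omega: "of_alg a \<in> Omega 0"
  by (simp add: Omega_0)

section \<open>The basis of one-forms\<close>

lemma e_in_Omega: "e1 \<in> Omega 1" "e2 \<in> Omega 1"
  using diff_Omega[of "of_alg _" 0] by (auto simp: e1_def e2_def Omega_0)

lemma coeff_e: "coeff e1 [x, y] = chr 1 y - chr 1 x" "coeff e2 [x, y] = chr 2 y - chr 2 x"
  by (simp_all add: e1_def e2_def coeff_diff_of_alg)

lemma distinct_points: "(1::3) \<noteq> 2" "(1::3) \<noteq> 3" "(2::3) \<noteq> 3" "(2::3) \<noteq> 1" "(3::3) \<noteq> 1" "(3::3) \<noteq> 2"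
  by simp_all

text \<open>Right multiplication by \<open>A\<close> sees only the endpoint of an edge. The six edge
  equations thus split into three triangular systems, the one at endpoint \<open>y\<close> having
  the unknowns \<open>a y\<close> and \<open>b y\<close>.\<close>

lemma Omega_1_eq_basis_iff:
  assumes "\<xi> \<in> Omega 1"
  shows "\<xi> = e1 * of_alg a + e2 * of_alg b \<longleftrightarrow>
    a 1 = coeff \<xi> [3, 1] \<and> a 2 = coeff \<xi> [3, 2] - coeff \<xi> [1, 2] \<and> a 3 = - coeff \<xi> [1, 3] \<and>
    b 1 = coeff \<xi> [3, 1] - coeff \<xi> [2, 1] \<and> b 2 = coeff \<xi> [3, 2] \<and> b 3 = - coeff \<xi> [2, 3]"
    (is "?L \<longleftrightarrow> ?R")
proof -
  let ?\<eta> = "e1 * of_alg a + e2 * of_alg b"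
  have "?\<eta> \<in> Omega 1" using Omega_times[OF e_in_Omega(1) of_alg_Omega] Omega_times[OF e_in_Omega(2) of_alg_Omega]
    by (simp add: Omega_add)
  hence "?L \<longleftrightarrow> (\<forall>x y. x \<noteq> y \<longrightarrow> coeff \<xi> [x, y] = coeff ?\<eta> [x, y])"
    using Omega_1_eqI assms by metis
  also have "\<dots> \<longleftrightarrow> ?R"
    unfolding forall_3 by (auto simp: coeff_e chr_def distinct_points)
  finally show ?thesis .
qed

lemma alg_eq_iff: "(f::alg) = g \<longleftrightarrow> f 1 = g 1 \<and> f 2 = g 2 \<and> f 3 = g 3"
  by (auto simp: fun_eq_iff forall_3)

lemma unique_basis_expansion:
  assumes "\<xi> \<in> Omega 1"
  shows "\<exists>!(a, b). \<xi> = e1 * of_alg a + e2 * of_alg b"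
proof -
  define f :: "complex \<Rightarrow> complex \<Rightarrow> complex \<Rightarrow> alg"
    where "f p q r = (\<lambda>y. if y = 1 then p else if y = 2 then q else r)" for p q r
  have *: "(case z of (a, b) \<Rightarrow> \<xi> = e1 * of_alg a + e2 * of_alg b) \<longleftrightarrow>
      z = (f (coeff \<xi> [3, 1]) (coeff \<xi> [3, 2] - coeff \<xi> [1, 2]) (- coeff \<xi> [1, 3]),
        f (coeff \<xi> [3, 1] - coeff \<xi> [2, 1]) (coeff \<xi> [3, 2]) (- coeff \<xi> [2, 3]))" for z
    by (cases z) (simp add: Omega_1_eq_basis_iff[OF assms] alg_eq_iff f_def distinct_points)
  show ?thesis by (rule ex1I, rule *[THEN iffD2], rule refl, rule *[THEN iffD1])
qed

section \<open>Derivations that vanish on the algebra\<close>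

fun edge_sum :: "('a \<Rightarrow> 'a \<Rightarrow> 'b) \<Rightarrow> 'a list \<Rightarrow> 'b::monoid_add" where
  "edge_sum c (x # y # zs) = c x y + edge_sum c (y # zs)"
| "edge_sum c _ = 0"

text \<open>The two pieces share the point at position \<open>k\<close> but no step, so each step is
  counted once. This is the Leibniz rule of \<open>edge_op\<close> at the level of walks.\<close>

lemma edge_sum_split:
  "k < length w \<Longrightarrow> edge_sum c w = edge_sum c (take (Suc k) w) + edge_sum c (drop k w)"
proof (induction c w arbitrary: k rule: edge_sum.induct)
  case (1 c x y zs)
  thus ?case by (cases k) (simp_all add: add.assoc)
qed simp_all

lift_definition edge_op_u :: "(3 \<Rightarrow> 3 \<Rightarrow> complex) \<Rightarrow> uform \<Rightarrow> uform" is
  "\<lambda>c f w. edge_sum c w * f w"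
  by (auto simp: is_uform_def elim: rev_finite_subset)

text \<open>The operator is diagonal on walks and so preserves \<open>J0\<close>.\<close>

lift_definition edge_op :: "(3 \<Rightarrow> 3 \<Rightarrow> complex) \<Rightarrow> form \<Rightarrow> form" is edge_op_u
  by (simp add: connes_rel_def connes_ideal_eq_J0 J0_iff minus_uform.rep_eq edge_op_u.rep_eq)

lemma coeff_edge_op [simp]: "coeff (edge_op c \<xi>) w = edge_sum c w * coeff \<xi> w"
  by transfer (simp add: edge_op_u.rep_eq)

lemma linear_form_iff:
  "Vector_Spaces.linear scale scale T \<longleftrightarrow>
    (\<forall>\<xi> \<eta>. T (\<xi> + \<eta>) = T \<xi> + T \<eta>) \<and> (\<forall>a \<xi>. T (scale a \<xi>) = scale a (T \<xi>))"
  using vector_space_form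
  by (auto simp: Vector_Spaces.linear_def module_hom_def module_hom_axioms_def
      vector_space_def module_def)

lemma linear_edge_op: "Vector_Spaces.linear scale scale (edge_op c)"
  unfolding linear_form_iff by (auto intro!: form_eqI simp: algebra_simps)

lemma edge_op_times: "edge_op c (\<xi> * \<eta>) = edge_op c \<xi> * \<eta> + \<xi> * edge_op c \<eta>"
proof (rule form_eqI)
  fix w
  show "coeff (edge_op c (\<xi> * \<eta>)) w = coeff (edge_op c \<xi> * \<eta> + \<xi> * edge_op c \<eta>) w"
  proof (cases "card (set w) \<le> 2")
    case True
    have "edge_sum c w * (coeff \<xi> (take (Suc k) w) * coeff \<eta> (drop k w)) =
        edge_sum c (take (Suc k) w) * coeff \<xi> (take (Suc k) w) * coeff \<eta> (drop k w) +
        coeff \<xi> (take (Suc k) w) * (edge_sum c (drop k w) * coeff \<eta> (drop k w))"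
      if "k < length w" for k
      by (simp add: edge_sum_split[OF that, of c] algebra_simps)
    thus ?thesis
      by (simp add: coeff_times[OF True] sum_distrib_left flip: sum.distrib)
  next
    \<comment> \<open>\<open>coeff_times\<close> covers only walks through at most two points; on
      all others every form has coefficient 0.\<close>
    case False
    thus ?thesis using coeff_nonzero(3) by metis
  qed
qed

lemma edge_op_of_alg: "edge_op c (of_alg a) = 0"
  by (rule form_eqI) (auto simp: coeff_of_alg length_Suc_conv)

lemma edge_op_Omega: "\<xi> \<in> Omega n \<Longrightarrow> edge_op c \<xi> \<in> Omega n"
  by (simp add: Omega_iff)

lemma star_Omega: "\<xi> \<in> Omega n \<Longrightarrow> star \<xi> \<in> Omega n"
  by (auto simp: Omega_iff coeff_star)

text \<open>Both sides are linear derivations that vanish on \<open>A\<close>, and every walk is a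
  product of edges, so it suffices to compare them on single edges.\<close>

lemma derivation_eq_edge_op:
  assumes lin: "Vector_Spaces.linear scale scale J"
    and deg: "\<And>\<xi>. \<xi> \<in> Omega 1 \<Longrightarrow> J \<xi> \<in> Omega 1"
    and mult: "\<And>\<xi> \<eta>. J (\<xi> * \<eta>) = J \<xi> * \<eta> + \<xi> * J \<eta>"
    and alg: "\<And>a. J (of_alg a) = 0"
  shows "J = edge_op (\<lambda>x y. coeff (J (abs_form (word_u 1 [x, y]))) [x, y])"
proof -
  define c where "c x y = coeff (J (abs_form (word_u 1 [x, y]))) [x, y]" for x y
  have J: "J (\<xi> + \<eta>) = J \<xi> + J \<eta>" "J (scale a \<xi>) = scale a (J \<xi>)" for \<xi> \<eta> a
    using lin unfolding linear_form_iff by auto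
  have E: "edge_op c (\<xi> + \<eta>) = edge_op c \<xi> + edge_op c \<eta>"
    "edge_op c (scale a \<xi>) = scale a (edge_op c \<xi>)" for \<xi> \<eta> a
    using linear_edge_op unfolding linear_form_iff by auto
  have "J 0 = 0" "edge_op c 0 = 0" using J(1)[of 0 0] E(1)[of 0 0] by simp_all
  have one_step: "J (abs_form (word_u 1 [x, y])) = edge_op c (abs_form (word_u 1 [x, y]))"
    if xy: "x \<noteq> y" for x y
  proof (rule Omega_1_eqI)
    let ?\<xi> = "abs_form (word_u 1 [x, y])"
    have "?\<xi> \<in> Omega 1" unfolding Omega_def by (rule imageI[OF word_u_deg])
    thus "J ?\<xi> \<in> Omega 1" "edge_op c ?\<xi> \<in> Omega 1" by (rule deg, rule edge_op_Omega)
    fix p q :: 3 assume "p \<noteq> q"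
    \<comment> \<open>The Leibniz rule and \<open>alg\<close> make \<open>J\<close> a bimodule map.
      Sandwiching between \<open>chr x\<close> and \<open>chr y\<close> then forces the image of an
      edge to be supported on that edge.\<close>
    have "?\<xi> = of_alg (chr x) * ?\<xi> * of_alg (chr y)"
      using xy by (simp add: of_alg.abs_eq abs_form_simps of_alg_u_times_word chr_def)
    hence "J ?\<xi> = of_alg (chr x) * J ?\<xi> * of_alg (chr y)"
      by (metis mult alg mult_zero_left mult_zero_right add_0 add_0_right)
    hence "coeff (J ?\<xi>) [p, q] = chr x p * coeff (J ?\<xi>) [p, q] * chr y q"
      by (metis coeff_times_of_alg)
    thus "coeff (J ?\<xi>) [p, q] = coeff (edge_op c ?\<xi>) [p, q]"
      using xy by (auto simp: chr_def c_def coeff_abs_form card_pair_le_2 word_u.rep_eq split: if_splits)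
  qed
  have scale: "abs_form (word_u a w) = scale a (abs_form (word_u 1 w))" for a w
    by (rule form_eqI) (simp add: coeff_abs_form word_u.rep_eq)
  have word: "J (abs_form (word_u a w)) = edge_op c (abs_form (word_u a w))"
    if "w \<noteq> []" "distinct_adj w" for a w
    using that
  proof (induction w arbitrary: a rule: induct_list012)
    case (2 x)
    have "abs_form (word_u a [x]) = of_alg (\<lambda>y. a * chr x y)"
      by (rule form_eqI) (auto simp: coeff_abs_form word_u.rep_eq coeff_of_alg chr_def length_Suc_conv)
    thus ?case by (simp add: alg edge_op_of_alg)
  next
    case (3 x y zs)
    \<comment> \<open>The first edge is split off and carries the scalar.\<close>
    have "word_u a (x # y # zs) = word_u a [x, y] * word_u 1 (y # zs)"
      using 3 by (subst word_u_times) auto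
    hence *: "abs_form (word_u a (x # y # zs)) =
        abs_form (word_u a [x, y]) * abs_form (word_u 1 (y # zs))"
      by (simp add: abs_form_simps)
    have "J (abs_form (word_u a [x, y])) = edge_op c (abs_form (word_u a [x, y]))"
      using one_step 3 by (simp add: scale[of a] J E)
    moreover have "J (abs_form (word_u 1 (y # zs))) = edge_op c (abs_form (word_u 1 (y # zs)))"
      using 3 by simp
    ultimately show ?case by (simp add: * mult edge_op_times)
  qed simp_all
  have "J (abs_form \<omega>) = edge_op c (abs_form \<omega>)" for \<omega>
  proof (induction \<omega> rule: uform_induct)
    case zero
    thus ?case using \<open>J 0 = 0\<close> \<open>edge_op c 0 = 0\<close> by (simp add: zero_form.abs_eq)
  next
    case (add a w \<omega>)
    thus ?case by (simp add: word J E flip: abs_form_simps(1))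
  qed
  hence "J \<xi> = edge_op c \<xi>" for \<xi> by (induction \<xi> rule: form.abs_induct)
  thus ?thesis unfolding c_def by blast
qed

section \<open>Complex structures and their matrices\<close>

lemma edge_sum_cong:
  assumes "\<And>x y. x \<noteq> y \<Longrightarrow> c x y = c' x y" "distinct_adj w"
  shows "edge_sum c w = edge_sum c' w"
  using assms(2) by (induction w rule: induct_list012) (auto simp: assms(1))

text \<open>Walks in the support of a form never stay at a point, so the diagonal of
  \<open>c\<close> does not contribute.\<close>

lemma edge_op_cong:
  assumes "\<And>x y. x \<noteq> y \<Longrightarrow> c x y = c' x y"
  shows "edge_op c = edge_op c'"
proof (intro ext form_eqI)
  fix \<xi> w
  show "coeff (edge_op c \<xi>) w = coeff (edge_op c' \<xi>) w"
  proof (cases "coeff \<xi> w = 0")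
    case False
    thus ?thesis using edge_sum_cong[OF assms coeff_nonzero(2)[OF False]] by simp
  qed simp
qed

lemma almost_complex_edge_op_iff:
  "almost_complex_structure (edge_op c) \<longleftrightarrow>
    (\<forall>x y. x \<noteq> y \<longrightarrow> c x y \<in> {\<i>, - \<i>} \<and> c y x = - c x y)" (is "_ \<longleftrightarrow> ?R")
proof
  assume J: "almost_complex_structure (edge_op c)"
  show ?R
  proof (intro allI impI)
    fix x y :: 3 assume xy: "x \<noteq> y"
    let ?\<xi> = "abs_form (word_u 1 [x, y])"
    have \<xi>: "?\<xi> \<in> Omega 1" using word_u_deg by (auto simp: Omega_def)
    have coeff: "coeff ?\<xi> [x, y] = 1"
      using xy by (simp add: coeff_abs_form card_pair_le_2 word_u.rep_eq)
    have "edge_op c (edge_op c ?\<xi>) = - ?\<xi>"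
      using J \<xi> unfolding almost_complex_structure_def by blast
    \<comment> \<open>Writing -1 as the square of \<open>\<i>\<close> lets
      \<open>square_eq_iff\<close> list the roots.\<close>
    from arg_cong[OF this, of "\<lambda>\<eta>. coeff \<eta> [x, y]"] have "c x y * c x y = \<i> * \<i>"
      by (simp add: coeff)
    hence 1: "c x y \<in> {\<i>, - \<i>}" by (simp only: square_eq_iff) auto
    have "edge_op c (star ?\<xi>) = star (edge_op c ?\<xi>)"
      using J \<xi> unfolding almost_complex_structure_def by blast
    \<comment> \<open>The involution reverses walks, hence the evaluation at the reversed edge; its
      degree one sign occurs on both sides and cancels.\<close>
    from arg_cong[OF this, of "\<lambda>\<eta>. coeff \<eta> [y, x]"] have "c y x = cnj (c x y)"
      by (simp add: coeff_star coeff)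
    thus "c x y \<in> {\<i>, - \<i>} \<and> c y x = - c x y" using 1 by auto
  qed
next
  assume c: ?R
  have sq: "c x y * c x y = -1" if "x \<noteq> y" for x y
  proof -
    have "c x y \<in> {\<i>, - \<i>}" using c that by blast
    thus ?thesis by auto
  qed
  have cnj: "c x y = cnj (c y x)" if "x \<noteq> y" for x y
  proof -
    have "c y x \<in> {\<i>, - \<i>}" "c x y = - c y x" using c that[symmetric] by blast+
    thus ?thesis by auto
  qed
  have "edge_op c (edge_op c \<xi>) = - \<xi>" if \<xi>: "\<xi> \<in> Omega 1" for \<xi>
  proof (rule Omega_1_eqI)
    show "- \<xi> \<in> Omega 1" using \<xi> by (simp add: Omega_iff)
  qed (use \<xi> edge_op_Omega in \<open>auto simp: sq simp flip: mult.assoc\<close>)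
  moreover have "edge_op c (star \<xi>) = star (edge_op c \<xi>)" if \<xi>: "\<xi> \<in> Omega 1" for \<xi>
  proof (rule Omega_1_eqI)
    fix x y :: 3 assume "x \<noteq> y"
    thus "coeff (edge_op c (star \<xi>)) [x, y] = coeff (star (edge_op c \<xi>)) [x, y]"
      using cnj[of x y] by (simp add: coeff_star)
  qed (use \<xi> edge_op_Omega star_Omega in blast)+
  ultimately show "almost_complex_structure (edge_op c)"
    unfolding almost_complex_structure_def
    using linear_edge_op edge_op_times edge_op_of_alg edge_op_Omega by blast
qed

lemma complex_structure_edge_op_iff:
  "complex_structure (edge_op c) \<longleftrightarrow> almost_complex_structure (edge_op c)"
proof
  assume J: "almost_complex_structure (edge_op c)"
  have c: "c x y + c y x = 0" if "x \<noteq> y" for x y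
    using J[unfolded almost_complex_edge_op_iff, rule_format, OF that] by simp
  have "edge_op c \<eta> = 0" if \<eta>: "\<eta> \<in> Omega 2" for \<eta>
  proof (rule form_eqI)
    fix w
    show "coeff (edge_op c \<eta>) w = coeff 0 w"
    proof (cases "coeff \<eta> w = 0")
      case False
      hence w: "length w = 3" "distinct_adj w" "card (set w) \<le> 2"
        using \<eta> coeff_nonzero[OF False] by (auto simp: Omega_iff)
      then obtain x y z where xyz: "w = [x, y, z]" "x \<noteq> y" "y \<noteq> z"
        by (auto simp: length_Suc_conv numeral_3_eq_3)
      hence "z = x" using w(3) by (auto simp: card_insert_if split: if_splits)
      thus ?thesis using xyz c by simp
    qed simp
  qed
  \<comment> \<open>Type (1,1) means eigenvalue 0, so all of \<open>Omega 2\<close> has this type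
    and the (2,0) part of \<open>diff \<xi>\<close> can be taken to be 0.\<close>
  hence "Omega 2 \<subseteq> Omega_pq (edge_op c) 1 1"
    by (auto intro!: form_eqI simp: Omega_pq_def numeral_2_eq_2)
  moreover have "0 \<in> Omega_pq (edge_op c) 2 0"
    by (auto intro!: form_eqI simp: Omega_pq_def Omega_iff)
  moreover have "diff \<xi> \<in> Omega 2" if "\<xi> \<in> Omega_pq (edge_op c) 1 0" for \<xi>
    using that diff_Omega[of \<xi> 1] by (auto simp: Omega_pq_def numeral_2_eq_2)
  ultimately show "complex_structure (edge_op c)"
    unfolding complex_structure_def using J by (metis add_0 subsetD)
qed (simp add: complex_structure_def)

text \<open>The values on the diagonal are irrelevant (see \<open>edge_op_cong\<close>).\<close>

definition orientation :: "complex \<times> complex \<times> complex \<Rightarrow> 3 \<Rightarrow> 3 \<Rightarrow> complex" where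
  "orientation = (\<lambda>(p, q, r) x y.
     if x = 1 \<and> y = 2 then p else if x = 2 \<and> y = 1 then - p
     else if x = 2 \<and> y = 3 then q else if x = 3 \<and> y = 2 then - q
     else if x = 1 \<and> y = 3 then r else - r)"

definition imag_units :: "(complex \<times> complex \<times> complex) set" where
  "imag_units = {\<i>, - \<i>} \<times> {\<i>, - \<i>} \<times> {\<i>, - \<i>}"

lemma orientation_simps [simp]:
  "orientation (p, q, r) 1 2 = p" "orientation (p, q, r) 2 1 = - p"
  "orientation (p, q, r) 2 3 = q" "orientation (p, q, r) 3 2 = - q"
  "orientation (p, q, r) 1 3 = r" "orientation (p, q, r) 3 1 = - r"
  by (simp_all add: orientation_def distinct_points)

lemma complex_structures_eq: "{J. complex_structure J} = (edge_op \<circ> orientation) ` imag_units"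
proof (intro subset_antisym subsetI)
  fix J assume "J \<in> {J. complex_structure J}"
  hence J: "complex_structure J" and aJ: "almost_complex_structure J"
    by (simp_all add: complex_structure_def)
  obtain c where c: "J = edge_op c"
    using derivation_eq_edge_op[of J] aJ unfolding almost_complex_structure_def by blast
  have *: "c x y \<in> {\<i>, - \<i>} \<and> c y x = - c x y" if "x \<noteq> y" for x y
    using aJ that unfolding c almost_complex_edge_op_iff by blast
  \<comment> \<open>One value for each pair of points; antisymmetry gives the opposite
    edges.\<close>
  let ?t = "(c 1 2, c 2 3, c 1 3)"
  have "\<forall>x y. x \<noteq> y \<longrightarrow> c x y = orientation ?t x y"
    unfolding forall_3 using *[of 1 2] *[of 2 3] *[of 1 3] by (simp add: distinct_points)
  hence "edge_op c = edge_op (orientation ?t)" by (intro edge_op_cong) blast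
  hence "J = (edge_op \<circ> orientation) ?t" by (simp add: c)
  moreover have "?t \<in> imag_units"
    unfolding imag_units_def using *[OF distinct_points(1)] *[OF distinct_points(2)]
      *[OF distinct_points(3)] by blast
  ultimately show "J \<in> (edge_op \<circ> orientation) ` imag_units" by blast
next
  fix J assume "J \<in> (edge_op \<circ> orientation) ` imag_units"
  then obtain p q r where J: "J = edge_op (orientation (p, q, r))" and
    pqr: "p \<in> {\<i>, - \<i>}" "q \<in> {\<i>, - \<i>}" "r \<in> {\<i>, - \<i>}"
    by (auto simp: imag_units_def)
  have m: "- z \<in> {\<i>, - \<i>}" if "z \<in> {\<i>, - \<i>}" for z using that by auto
  have "\<forall>x y. x \<noteq> y \<longrightarrow> orientation (p, q, r) x y \<in> {\<i>, - \<i>} \<and>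
      orientation (p, q, r) y x = - orientation (p, q, r) x y"
    unfolding forall_3 using pqr pqr[THEN m] by (simp only: orientation_simps minus_minus simp_thms)
  thus "J \<in> {J. complex_structure J}"
    by (simp only: J mem_Collect_eq complex_structure_edge_op_iff almost_complex_edge_op_iff)
qed

section \<open>The matrices of the eight structures\<close>

lemma matrix_of_eqI:
  assumes "J e1 \<in> Omega 1" "J e2 \<in> Omega 1"
    and "J e1 = e1 * of_alg (M $ 1 $ 1) + e2 * of_alg (M $ 2 $ 1)"
    and "J e2 = e1 * of_alg (M $ 1 $ 2) + e2 * of_alg (M $ 2 $ 2)"
  shows "matrix_of J = M"
  unfolding matrix_of_def
proof (rule the_equality)
  fix N :: "alg^2^2"
  assume "J e1 = e1 * of_alg (N $ 1 $ 1) + e2 * of_alg (N $ 2 $ 1) \<and>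
    J e2 = e1 * of_alg (N $ 1 $ 2) + e2 * of_alg (N $ 2 $ 2)"
  \<comment> \<open>Both matrices have the same explicit coordinates, which exist because
    \<open>J e1\<close> and \<open>J e2\<close> are one-forms.\<close>
  with assms(3,4) show "N = M"
    unfolding Omega_1_eq_basis_iff[OF assms(1)] Omega_1_eq_basis_iff[OF assms(2)]
    by (intro mat22_eqI) (simp_all add: alg_eq_iff)
qed (use assms in blast)

text \<open>The columns are the coordinates from \<open>Omega_1_eq_basis_iff\<close> of the images
  of \<open>e1\<close> and \<open>e2\<close>, where \<open>p\<close>, \<open>q\<close>,
  \<open>r\<close> weight the edges 12, 23, 13.\<close>

definition orientation_mat :: "complex \<times> complex \<times> complex \<Rightarrow> alg^2^2" where
  "orientation_mat = (\<lambda>(p, q, r). mat22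
     (\<lambda>y. if y = 1 then - r else if y = 2 then p else r) (\<lambda>y. if y = 2 then - q - p else 0)
     (\<lambda>y. if y = 1 then p - r else 0) (\<lambda>y. if y = 1 then - p else if y = 2 then - q else q))"

lemma matrix_of_edge_op: "matrix_of (edge_op (orientation t)) = orientation_mat t"
proof (cases t)
  case (fields p q r)
  have *: "edge_op (orientation t) e1 \<in> Omega 1" "edge_op (orientation t) e2 \<in> Omega 1"
    by (intro edge_op_Omega e_in_Omega)+
  show ?thesis
    by (rule matrix_of_eqI[OF *], unfold *[THEN Omega_1_eq_basis_iff])
      (simp_all add: coeff_e fields orientation_mat_def chr_def distinct_points)
qed

lemma inj_orientation_mat: "inj orientation_mat"
proof (rule injI)
  fix s t assume "orientation_mat s = orientation_mat t"
  hence "(orientation_mat s $ 1 $ 1) y = (orientation_mat t $ 1 $ 1) y"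
    "(orientation_mat s $ 2 $ 2) y = (orientation_mat t $ 2 $ 2) y" for y by simp_all
  \<comment> \<open>These three values are \<open>p\<close>, \<open>r\<close> and \<open>q\<close>,
    in this order.\<close>
  from this(1)[of 2] this(1)[of 3] this(2)[of 3] show "s = t"
    by (cases s; cases t) (simp add: orientation_mat_def distinct_points)
qed

text \<open>Evaluates the 2 in the listed matrices, which is an element of the function
  ring.\<close>

lemma numeral_alg_apply: "(numeral n :: alg) x = numeral n"
proof -
  have "(of_nat k :: alg) x = of_nat k" for k by (induction k) simp_all
  thus ?thesis by (metis of_nat_numeral)
qed

text \<open>The third weight is always \<open>- c\<close>, while the four matrices run through the
  four sign choices for the first two. Letting \<open>c\<close> be \<open>\<i>\<close> or
  \<open>- \<i>\<close> thus reaches every triple once.\<close>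

lemma scale_mat_eq_orientation_mat:
  "scale_mat c (mat22 (1 - 2 * chr 3) 0 (2 * chr 1) (2 * chr 2 - 1)) = orientation_mat (c, - c, - c)"
  "scale_mat c (mat22 (1 - 2 * chr 3) (- 2 * chr 2) (2 * chr 1) (2 * chr 3 - 1)) =
    orientation_mat (c, c, - c)"
  "scale_mat c (mat22 (2 * chr 1 - 1) (2 * chr 2) 0 (1 - 2 * chr 3)) = orientation_mat (- c, - c, - c)"
  "scale_mat c (mat22 (2 * chr 1 - 1) 0 0 (1 - 2 * chr 2)) = orientation_mat (- c, c, - c)"
  by (auto intro!: mat22_eqI simp: alg_eq_iff scale_mat_def orientation_mat_def const_alg_def chr_def
      numeral_alg_apply distinct_points)

theorem theorem23:
  shows "e1 \<in> Omega 1 \<and> e2 \<in> Omega 1 \<and>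
    (\<forall>\<xi>\<in>Omega 1. \<exists>!(a, b). \<xi> = e1 * of_alg a + e2 * of_alg b) \<and>
    card {J. complex_structure J} = 8 \<and>
    bij_betw matrix_of {J. complex_structure J}
      (\<Union>M \<in> {mat22 (1 - 2 * chr 3) 0 (2 * chr 1) (2 * chr 2 - 1),
              mat22 (1 - 2 * chr 3) (- 2 * chr 2) (2 * chr 1) (2 * chr 3 - 1),
              mat22 (2 * chr 1 - 1) (2 * chr 2) 0 (1 - 2 * chr 3),
              mat22 (2 * chr 1 - 1) 0 0 (1 - 2 * chr 2)}.
        {scale_mat \<i> M, scale_mat (- \<i>) M})" (is "_ \<and> _ \<and> _ \<and> _ \<and> bij_betw _ _ ?B")
proof -
  let ?F = "edge_op \<circ> orientation"
  have comp: "matrix_of \<circ> ?F = orientation_mat" by (simp add: fun_eq_iff matrix_of_edge_op)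
  have mat: "bij_betw (matrix_of \<circ> ?F) imag_units (orientation_mat ` imag_units)"
    unfolding comp using inj_orientation_mat by (auto simp: bij_betw_def intro: inj_on_subset)
  \<comment> \<open>\<open>?F\<close> is injective because its composite with
    \<open>matrix_of\<close> is.\<close>
  hence F: "bij_betw ?F imag_units {J. complex_structure J}"
    using inj_on_imageI2 by (auto simp: bij_betw_def complex_structures_eq)
  have "card imag_units = 8"
    by (simp add: imag_units_def card_cartesian_product card_insert_if)
  hence card: "card {J. complex_structure J} = 8"
    using bij_betw_same_card[OF F] by simp
  \<comment> \<open>Listed in the order in which the matrices of the statement, each with both
    signs, produce the triples.\<close>
  have imag: "imag_units = {(\<i>, - \<i>, - \<i>), (- \<i>, \<i>, \<i>), (\<i>, \<i>, - \<i>), (- \<i>, - \<i>, \<i>),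
      (- \<i>, - \<i>, - \<i>), (\<i>, \<i>, \<i>), (- \<i>, \<i>, - \<i>), (\<i>, - \<i>, \<i>)}"
    unfolding imag_units_def by blast
  have B: "?B = orientation_mat ` imag_units"
    unfolding UN_insert UN_empty imag image_insert image_empty scale_mat_eq_orientation_mat
      minus_minus
    by (simp only: Union_insert Union_empty Un_insert_left Un_empty_left Un_empty_right)
  \<comment> \<open>Precomposition with the bijection \<open>?F\<close> reduces the claim to
    \<open>mat\<close>.\<close>
  have "bij_betw matrix_of {J. complex_structure J} ?B"
    unfolding B bij_betw_comp_iff[OF F] by (rule mat)
  thus ?thesis using e_in_Omega unique_basis_expansion card by blast
qed

end
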